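(* Let $H$ be a separable infinite-dimensional complex Hilbert space and let $J$ be a two-sided ideal of $B(H)$. (1) Let $\mathscr S \subset J$ be a set of cardinality strictly less than $\mathfrak c$. Then the $J$-ideal $(\mathscr S)_J$ generated by $\mathscr S$ is a $B(H)$-ideal if and only if the $B(H)$-ideal $(\mathscr S)$ generated by $\mathscr S$ is $J$-soft, i.e., $(\mathscr S) = (\mathscr S)J$. (2) Moreover, let $\mathcal I$ be a $J$-ideal such that the Hamel dimension of the quotient vector space $\mathcal I/\mathcal I^0$ is strictly less than $\mathfrak c$, where $\mathcal I^0 := \operatorname{span}\{\mathcal I J + J\mathcal I\} + J(\mathcal I)J$. Then $\mathcal I$ is a $B(H)$-ideal if and only if the $B(H)$-ideal $(\mathcal I)$ generated by $\mathcal I$ is $J$-soft, i.e., $(\mathcal I) = (\mathcal I)J$.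
   Context: $B(H)$ is the algebra of bounded linear operators on $H$, and $\mathfrak c$ is the cardinality of the continuum. A $B(H)$-ideal is a two-sided ideal of $B(H)$ (not necessarily norm-closed). For a $B(H)$-ideal $J$, a $J$-ideal (subideal) is a complex linear subspace $\mathcal I \subset J$ with $AX, XA \in \mathcal I$ for all $A\in J$, $X \in \mathcal I$. For $\mathscr S \subset J$, $(\mathscr S)$ is the smallest $B(H)$-ideal containing $\mathscr S$ and $(\mathscr S)_J$ is the smallest $J$-ideal containing $\mathscr S$. For a $J$-ideal $\mathcal I$, $(\mathcal I)$ is the smallest $B(H)$-ideal containing $\mathcal I$. The product $I_1I_2$ of two $B(H)$-ideals is the $B(H)$-ideal of all finite sums $\sum_i A_iB_i$ with $A_i\in I_1$, $B_i\in I_2$ (this product is commutative and associative); in particular $J(\mathcal I)J$ is a triple product of $B(H)$-ideals. A $B(H)$-ideal $I$ is called $J$-soft if $IJ = I$. For a $J$-ideal $\mathcal I$, $\mathcal I J := \{AB \mid A\in\mathcal I, B\in J\}$, $J\mathcal I := \{BA \mid B\in J, A\in\mathcal I\}$, and $\operatorname{span}\{\mathcal I J + J\mathcal I\}$ is the complex linear span of $\mathcal I J\cup J\mathcal I$. $\mathcal I^0$ is a linear subspace of $\mathcal I$. Hamel dimension means the cardinality of an algebraic vector space basis. *)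

theory Defs
  imports "HOL-Analysis.Analysis" "HOL-Library.Equipollence" "HOL-Library.Set_Algebras"
begin

text \<open>
  Complex Hilbert spaces. The inner product \<open>cinner\<close> is linear in its first argument; positive
  definiteness and the norm identity are inherited from \<^class>\<open>real_inner\<close>, because
  \<open>cinner x x\<close> is real by conjugate symmetry and its real part is \<open>inner x x\<close>.
\<close>

class complex_hilbert_space = real_inner + complete_space +
  fixes scaleC :: "complex \<Rightarrow> 'a \<Rightarrow> 'a" (infixr "*\<^sub>C" 75)
    and cinner :: "'a \<Rightarrow> 'a \<Rightarrow> complex"
  assumes scaleC_add_right: "c *\<^sub>C (x + y) = c *\<^sub>C x + c *\<^sub>C y"
    and scaleC_add_left: "(c + d) *\<^sub>C x = c *\<^sub>C x + d *\<^sub>C x"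
    and scaleC_scaleC: "c *\<^sub>C d *\<^sub>C x = (c * d) *\<^sub>C x"
    and scaleC_of_real: "complex_of_real r *\<^sub>C x = r *\<^sub>R x"
    and cinner_commute: "cinner x y = cnj (cinner y x)"
    and cinner_add_left: "cinner (x + y) z = cinner x z + cinner y z"
    and cinner_scaleC_left: "cinner (c *\<^sub>C x) y = c * cinner x y"
    and Re_cinner: "Re (cinner x y) = inner x y"

interpretation cvec: vector_space "scaleC :: complex \<Rightarrow> 'a \<Rightarrow> 'a::complex_hilbert_space"
proof
  show "1 *\<^sub>C x = x" for x :: 'a
    using scaleC_of_real[of 1 x] by simp
qed (simp_all add: scaleC_add_right scaleC_add_left scaleC_scaleC)

lemma norm_scaleC: "norm (c *\<^sub>C x) = cmod c * norm (x::'a::complex_hilbert_space)"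
proof -
  have im: "Im (cinner x x) = 0"
    using cinner_commute[of x x] by (metis cnj.simps(2) neg_equal_zero)
  have "cinner x (c *\<^sub>C x) = cnj c * cinner x x"
    by (metis cinner_commute cinner_scaleC_left complex_cnj_mult)
  then have "cinner (c *\<^sub>C x) (c *\<^sub>C x) = complex_of_real ((cmod c)\<^sup>2) * cinner x x"
    by (simp add: cinner_scaleC_left mult.assoc[symmetric] complex_norm_square del: of_real_power)
  then have "inner (c *\<^sub>C x) (c *\<^sub>C x) = (cmod c)\<^sup>2 * inner x x"
    by (simp add: Re_cinner[symmetric] im)
  then show ?thesis
    by (simp add: norm_eq_sqrt_inner real_sqrt_mult)
qed

lemma bounded_linear_scaleC: "bounded_linear (\<lambda>x::'a::complex_hilbert_space. c *\<^sub>C x)"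
proof (rule bounded_linear_intro)
  show "c *\<^sub>C (r *\<^sub>R x) = r *\<^sub>R (c *\<^sub>C x)" for r and x :: 'a
    by (simp add: scaleC_of_real[symmetric] scaleC_scaleC mult.commute)
  show "norm (c *\<^sub>C x) \<le> norm x * cmod c" for x :: 'a
    by (simp add: norm_scaleC)
qed (rule scaleC_add_right)

text \<open>
  \<^typ>\<open>'a \<Rightarrow>\<^sub>L 'a\<close> is the type of real-linear bounded operators; \<open>BH\<close> carves out the
  complex-linear ones.
\<close>

definition BH :: "('a::complex_hilbert_space \<Rightarrow>\<^sub>L 'a) set"
  where "BH = {A. \<forall>c x. blinfun_apply A (c *\<^sub>C x) = c *\<^sub>C blinfun_apply A x}"

lift_definition scale_op :: "complex \<Rightarrow> ('a::complex_hilbert_space \<Rightarrow>\<^sub>L 'a) \<Rightarrow> ('a \<Rightarrow>\<^sub>L 'a)"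
  is "\<lambda>c A x. c *\<^sub>C A x"
  by (rule bounded_linear_compose[OF bounded_linear_scaleC])

text \<open>
  The quotient space \<open>V/W\<close> as a set of cosets. Sums of cosets are Minkowski sums; adding \<open>W\<close>
  makes multiplication by \<open>0\<close> and the empty sum yield the coset \<open>W\<close>
  rather than \<open>{0}\<close>. \<open>quotient_basis sm V W B\<close> says that \<open>B\<close> is a Hamel basis of \<open>V/W\<close> for the scalar
  multiplication \<open>sm\<close>.
\<close>

definition quotient_space :: "'b::ab_group_add set \<Rightarrow> 'b set \<Rightarrow> 'b set set"
  where "quotient_space V W = (\<lambda>v. v +o W) ` V"

definition coset_scale :: "('k \<Rightarrow> 'b::ab_group_add \<Rightarrow> 'b) \<Rightarrow> 'b set \<Rightarrow> 'k \<Rightarrow> 'b set \<Rightarrow> 'b set"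
  where "coset_scale sm W c X = sm c ` X + W"

definition coset_lincomb ::
    "('k \<Rightarrow> 'b::ab_group_add \<Rightarrow> 'b) \<Rightarrow> 'b set \<Rightarrow> 'b set set \<Rightarrow> ('b set \<Rightarrow> 'k) \<Rightarrow> 'b set"
  where "coset_lincomb sm W F c = (\<Sum>X\<in>F. coset_scale sm W (c X) X) + W"

definition quotient_basis ::
    "('k::zero \<Rightarrow> 'b::ab_group_add \<Rightarrow> 'b) \<Rightarrow> 'b set \<Rightarrow> 'b set \<Rightarrow> 'b set set \<Rightarrow> bool"
  where "quotient_basis sm V W B \<longleftrightarrow>
    B \<subseteq> quotient_space V W \<and>
    (\<forall>F c. finite F \<and> F \<subseteq> B \<and> coset_lincomb sm W F c = W \<longrightarrow> (\<forall>X\<in>F. c X = 0)) \<and>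
    (\<forall>Y\<in>quotient_space V W. \<exists>F c. finite F \<and> F \<subseteq> B \<and> Y = coset_lincomb sm W F c)"

lemma (in vector_space) coset_lincomb_cosets:
  assumes "subspace W" "finite F" "\<And>X. X \<in> F \<Longrightarrow> X = r X +o W"
  shows "coset_lincomb scale W F c = (\<Sum>X\<in>F. scale (c X) (r X)) +o W"
proof -
  have WW: "W + W = W"
    using assms(1) by (force simp: set_plus_def subspace_def)
  have sc: "coset_scale scale W a (v +o W) = scale a v +o W" for a v
  proof -
    have "coset_scale scale W a (v +o W) = scale a v +o (scale a ` W + W)"
      by (force simp: coset_scale_def set_plus_def elt_set_plus_def scale_right_distrib algebra_simps)
    moreover have "scale a ` W + W = W"
      using assms(1) subspace_scale[OF assms(1)] subspace_add[OF assms(1)]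
        subspace_0[OF assms(1)] by (force simp: set_plus_def)
    ultimately show ?thesis by simp
  qed
  show ?thesis using assms(2,3)
  proof (induction F)
    case empty
    then show ?case by (simp add: coset_lincomb_def)
  next
    case (insert X F)
    have "coset_scale scale W (c X) X = scale (c X) (r X) +o W"
      using insert.prems[of X] sc by (metis insertI1)
    moreover have "coset_lincomb scale W F c = (\<Sum>X\<in>F. scale (c X) (r X)) +o W"
      using insert by blast
    ultimately have "coset_lincomb scale W (insert X F) c
        = (scale (c X) (r X) +o W) + ((\<Sum>X\<in>F. scale (c X) (r X)) +o W)"
      using insert.hyps by (simp add: coset_lincomb_def add.assoc)
    also have "\<dots> = (scale (c X) (r X) + (\<Sum>X\<in>F. scale (c X) (r X))) +o (W + W)"
      by (simp add: set_plus_rearrange)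
    finally show ?case using insert.hyps WW by simp
  qed
qed

interpretation op: vector_space "scale_op :: complex \<Rightarrow> ('a::complex_hilbert_space \<Rightarrow>\<^sub>L 'a) \<Rightarrow> _"
  by standard
    (transfer; simp add: fun_eq_iff cvec.scale_left_distrib cvec.scale_right_distrib)+

definition subideal :: "('a::complex_hilbert_space \<Rightarrow>\<^sub>L 'a) set \<Rightarrow> ('a \<Rightarrow>\<^sub>L 'a) set \<Rightarrow> bool"
  where "subideal J I \<longleftrightarrow>
    I \<subseteq> J \<and> op.subspace I \<and> (\<forall>A\<in>J. \<forall>X\<in>I. A o\<^sub>L X \<in> I \<and> X o\<^sub>L A \<in> I)"

abbreviation BH_ideal :: "('a::complex_hilbert_space \<Rightarrow>\<^sub>L 'a) set \<Rightarrow> bool"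
  where "BH_ideal \<equiv> subideal BH"

definition ideal_prod ::
    "('a::complex_hilbert_space \<Rightarrow>\<^sub>L 'a) set \<Rightarrow> ('a \<Rightarrow>\<^sub>L 'a) set \<Rightarrow> ('a \<Rightarrow>\<^sub>L 'a) set"
  where "ideal_prod I\<^sub>1 I\<^sub>2 =
    {(\<Sum>i<n. A i o\<^sub>L B i) | (n::nat) A B. \<forall>i<n. A i \<in> I\<^sub>1 \<and> B i \<in> I\<^sub>2}"

definition soft :: "('a::complex_hilbert_space \<Rightarrow>\<^sub>L 'a) set \<Rightarrow> ('a \<Rightarrow>\<^sub>L 'a) set \<Rightarrow> bool"
  where "soft J I \<longleftrightarrow> ideal_prod I J = I"

text \<open>\<open>subideal_core J I\<close> is \<open>I\<^sup>0 = span (IJ + JI) + J(I)J\<close>, where \<open>(I)\<close> is the ideal of \<^term>\<open>BH\<close> generated by \<open>I\<close>.\<close>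

definition subideal_core ::
    "('a::complex_hilbert_space \<Rightarrow>\<^sub>L 'a) set \<Rightarrow> ('a \<Rightarrow>\<^sub>L 'a) set \<Rightarrow> ('a \<Rightarrow>\<^sub>L 'a) set"
  where "subideal_core J I =
    op.span ({A o\<^sub>L B | A B. A \<in> I \<and> B \<in> J} \<union> {B o\<^sub>L A | A B. A \<in> I \<and> B \<in> J})
    + ideal_prod (ideal_prod J (BH_ideal hull I)) J"

text \<open>The generated ideals, given by \<^const>\<open>hull\<close> as intersections, really are the smallest ones.\<close>

lemma BH_ideal_BH: "BH_ideal (BH :: ('a::complex_hilbert_space \<Rightarrow>\<^sub>L 'a) set)"
  unfolding subideal_def op.subspace_def BH_def
  by (auto simp: blinfun.add_left cvec.scale_right_distrib scale_op.rep_eq scaleC_scaleC mult.commute)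

lemma subideal_hull:
  assumes "BH_ideal J" "S \<subseteq> J"
  shows "subideal J (subideal J hull S)"
proof -
  have J: "subideal J J"
    using assms(1) by (auto simp: subideal_def)
  show ?thesis
  proof (intro subideal_def[THEN iffD2] conjI)
    show "subideal J hull S \<subseteq> J"
      using J assms(2) by (simp add: hull_minimal)
    show "op.subspace (subideal J hull S)"
      unfolding hull_def by (auto simp: subideal_def op.subspace_def)
    show "\<forall>A\<in>J. \<forall>X\<in>subideal J hull S. A o\<^sub>L X \<in> subideal J hull S \<and> X o\<^sub>L A \<in> subideal J hull S"
      unfolding hull_def by (auto simp: subideal_def)
  qed
qed

end

theory Submission imports Defs begin

text \<open>
  Products of ideals of \<open>B(H)\<close> commute, because by polar decomposition \<open>T\<^sup>* = U\<^sup>* T U\<^sup>*\<close> lies in every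
  ideal containing \<open>T\<close>. Hence softness \<open>(\<I>) = (\<I>)J\<close> gives \<open>(\<I>) = J(\<I>)J\<close>, which is always contained
  in \<open>\<I>\<close>.

  Conversely, if \<open>\<I>\<close> is an ideal of \<open>B(H)\<close>, the hypotheses say that \<open>\<I>/\<I>J\<close> has dimension less than
  the continuum. Suppose that \<open>T \<in> \<I>\<close> lies outside \<open>\<I>J\<close>. For \<open>s\<close> in an almost disjoint family of
  infinite sets of naturals of the size of the continuum, take an isometry \<open>V s\<close> of \<open>H\<close> onto the
  closed span of the corresponding basis vectors. As \<open>(V s)\<^sup>* V s = 1\<close>, while \<open>(V s)\<^sup>* V t\<close> has finite
  rank for \<open>s \<noteq> t\<close> and the nonzero ideal \<open>\<I>J\<close> contains the finite-rank operators, the operators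
  \<open>V s T \<in> \<I>\<close> are linearly independent modulo \<open>\<I>J\<close>, a contradiction.
\<close>

section \<open>Linear independence modulo a subspace\<close>

lemma UN_lepoll_infinite:
  assumes "infinite B" "I \<lesssim> B" "\<And>i. i \<in> I \<Longrightarrow> A i \<lesssim> B"
  shows "(\<Union>i\<in>I. A i) \<lesssim> B"
  using card_of_UNION_ordLeq_infinite[of B I A] assms
  by (simp add: lepoll_def card_of_ordLeq)

text \<open>Cut by length: \<open>A \<times> A \<approx> A\<close> bounds the lists of each fixed
  length by induction, and countably many such pieces still fit into \<open>A\<close>. Lists serve
  below as codes for finite subsets of a spanning set.\<close>

lemma infinite_lists_lepoll:
  assumes "infinite A"
  shows "lists A \<lesssim> A"
proof -
  have n: "{xs \<in> lists A. length xs = n} \<lesssim> A" for n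
  proof (induction n)
    case 0
    have "{xs \<in> lists A. length xs = 0} = {[]}" by auto
    then show ?case using assms by (simp add: finite_lepoll_infinite)
  next
    case (Suc n)
    have "xs \<in> (\<lambda>(x, xs). x # xs) ` (A \<times> {xs \<in> lists A. length xs = n})"
      if "xs \<in> {xs \<in> lists A. length xs = Suc n}" for xs
      using that by (cases xs) auto
    then have "{xs \<in> lists A. length xs = Suc n} \<lesssim> A \<times> {xs \<in> lists A. length xs = n}"
      by (intro subset_image_lepoll[of _ "\<lambda>(x, xs). x # xs"] subsetI)
    also have "\<dots> \<lesssim> A \<times> A" by (intro times_lepoll_mono Suc lepoll_refl)
    also have "A \<times> A \<approx> A"
      using card_of_Times_same_infinite[OF assms] by (simp add: eqpoll_iff_card_of_ordIso)
    finally show ?case .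
  qed
  have "lists A = (\<Union>n\<in>UNIV. {xs \<in> lists A. length xs = n})" by auto
  moreover have "(\<Union>n\<in>UNIV. {xs \<in> lists A. length xs = n}) \<lesssim> A"
    using n assms by (intro UN_lepoll_infinite) (simp_all add: infinite_le_lepoll)
  ultimately show ?thesis by simp
qed

lemma (in vector_space) span_finite_subset:
  assumes "x \<in> span S"
  shows "\<exists>T. finite T \<and> T \<subseteq> S \<and> x \<in> span T"
proof -
  obtain T r where "finite T" "T \<subseteq> S" "x = (\<Sum>a\<in>T. scale (r a) a)"
    using assms unfolding span_explicit by blast
  then show ?thesis by (blast intro: span_sum span_scale span_base)
qed

text \<open>Each \<open>x \<in> X\<close> lies in the span of a finite subset of \<open>R\<close>,
  coded by a list, and independence leaves only finitely many elements of \<open>X\<close> in such a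
  span. So \<open>X\<close> is covered by finite sets indexed by \<open>lists R\<close>.\<close>

lemma (in vector_space) independent_lepoll_spanning:
  assumes X: "independent X" "X \<subseteq> span R" and R: "infinite R"
  shows "X \<lesssim> R"
proof -
  have fin: "finite (X \<inter> span (set xs))" for xs
    using independent_span_bound[of "set xs" "X \<inter> span (set xs)"]
      independent_mono[OF X(1), of "X \<inter> span (set xs)"] by simp
  have "X \<subseteq> (\<Union>xs\<in>lists R. X \<inter> span (set xs))"
  proof
    fix x assume x: "x \<in> X"
    then obtain t where t: "finite t" "t \<subseteq> R" "x \<in> span t"
      using X(2) span_finite_subset[of x R] by auto
    obtain xs where "set xs = t" using t(1) finite_list by blast
    with t x have "xs \<in> lists R" "x \<in> X \<inter> span (set xs)" by auto
    then show "x \<in> (\<Union>xs\<in>lists R. X \<inter> span (set xs))" by (rule UN_I)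
  qed
  then have "X \<lesssim> (\<Union>xs\<in>lists R. X \<inter> span (set xs))" by (rule subset_imp_lepoll)
  also have "\<dots> \<lesssim> R"
    by (rule UN_lepoll_infinite[OF R infinite_lists_lepoll[OF R] finite_lepoll_infinite[OF R fin]])
  finally show ?thesis .
qed

text \<open>The index type \<open>nat set\<close> supplies the continuum. Replacing
  \<open>X s\<close> by a vector \<open>f s\<close> of \<open>span R\<close> congruent to it modulo
  \<open>K\<close> turns any relation among the \<open>f s\<close> into one among the
  \<open>X s\<close> modulo \<open>K\<close>; hence \<open>f\<close> is injective with independent
  range.\<close>

lemma (in vector_space) independent_mod_family_le:
  fixes X :: "nat set \<Rightarrow> 'b"
  assumes K: "subspace K" and span: "range X \<subseteq> span (R \<union> K)"
    and indep: "\<And>F c s. finite F \<Longrightarrow> (\<Sum>t\<in>F. scale (c t) (X t)) \<in> K \<Longrightarrow> s \<in> F \<Longrightarrow> c s = 0"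
  shows "\<not> R \<prec> (UNIV :: real set)"
proof
  assume R: "R \<prec> (UNIV :: real set)"
  have "\<exists>f. f \<in> span R \<and> X s - f \<in> K" for s
  proof -
    have "X s \<in> span (R \<union> K)" using span by auto
    then obtain f k where "f \<in> span R" "k \<in> span K" "X s = f + k"
      unfolding span_Un by auto
    moreover have "span K = K" using K by (simp add: span_eq_iff)
    ultimately show ?thesis by (intro exI[of _ f]) simp
  qed
  then obtain f where f: "\<And>s. f s \<in> span R" "\<And>s. X s - f s \<in> K" by metis
  have comb: "(\<Sum>t\<in>F. scale (c t) (X t)) \<in> K" if "(\<Sum>t\<in>F. scale (c t) (f t)) = 0" for F c
  proof -
    have "(\<Sum>t\<in>F. scale (c t) (X t)) = (\<Sum>t\<in>F. scale (c t) (X t - f t))"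
      using that by (simp add: scale_right_diff_distrib sum_subtractf)
    then show ?thesis using K f(2) by (simp add: subspace_sum subspace_scale)
  qed
  have inj: "inj f"
  proof (rule injI, rule ccontr)
    fix s t assume st: "f s = f t" "s \<noteq> t"
    then have "(\<Sum>r\<in>{s, t}. scale (if r = s then 1 else - 1) (f r)) = 0" by simp
    from comb[OF this] indep[of "{s, t}" "\<lambda>r. if r = s then 1 else - 1" s]
    show False by simp
  qed
  have ind: "independent (range f)"
    unfolding independent_explicit_finite_subsets
  proof (intro allI impI ballI)
    fix S u v assume S: "S \<subseteq> range f" "finite S" "(\<Sum>v\<in>S. scale (u v) v) = 0" "v \<in> S"
    let ?F = "f -` S"
    have "S = f ` ?F" using S(1) by auto
    then have "(\<Sum>t\<in>?F. scale (u (f t)) (f t)) = (\<Sum>v\<in>S. scale (u v) v)"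
      using inj by (metis (no_types, lifting) inj_on_subset subset_UNIV sum.reindex_cong)
    then have "(\<Sum>t\<in>?F. scale ((u \<circ> f) t) (X t)) \<in> K"
      using comb[of "u \<circ> f" ?F] S(3) by simp
    moreover have "finite ?F" using S(2) inj by (simp add: finite_vimageI)
    moreover obtain t where "v = f t" using S by blast
    ultimately show "u v = 0" using indep[of ?F "u \<circ> f" t] S(4) by simp
  qed
  have sp: "range f \<subseteq> span R" using f by auto
  have c: "(UNIV :: real set) \<lesssim> range f"
    using inj nat_sets_eqpoll_reals
    by (metis eqpoll_imp_lepoll eqpoll_sym eqpoll_trans inj_on_image_eqpoll_self)
  \<comment> \<open>The comparison of an independent set with a spanning set assumes the latter
    infinite, so finite \<open>R\<close> is treated apart.\<close>
  show False
  proof (cases "finite R")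
    case True
    then have "finite (range f)" using independent_span_bound[OF True ind sp] by simp
    then show False using c by (meson finite_subset infinite_UNIV_char_0 lepoll_def
          inj_on_finite)
  next
    case False
    then have "(UNIV :: real set) \<lesssim> R"
      using c independent_lepoll_spanning[OF ind sp] lepoll_trans by blast
    then show False using R using lepoll_antisym by (auto simp: lesspoll_def)
  qed
qed

section \<open>Operators on Hilbert space\<close>

lemma cinner_scaleC_right: "cinner x (c *\<^sub>C y) = cnj c * cinner x (y::'a::complex_hilbert_space)"
  by (metis cinner_commute cinner_scaleC_left complex_cnj_mult)

lemma cinner_add_right: "cinner x (y + z) = cinner x y + cinner x (z::'a::complex_hilbert_space)"
  by (metis cinner_commute cinner_add_left complex_cnj_add)

lemma cinner_self: "cinner x x = complex_of_real ((norm (x::'a::complex_hilbert_space))\<^sup>2)"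
proof -
  have "Im (cinner x x) = 0"
    using cinner_commute[of x x] by (metis cnj.simps(2) neg_equal_zero)
  then show ?thesis by (simp add: complex_eq_iff Re_cinner power2_norm_eq_inner)
qed

text \<open>Rotating \<open>x\<close> by a unimodular \<open>c\<close> makes the inner product real
  and nonnegative, so the real Cauchy-Schwarz inequality applies.\<close>

lemma cmod_cinner_le: "cmod (cinner x y) \<le> norm x * norm (y::'a::complex_hilbert_space)"
proof -
  obtain c where c: "cmod c = 1" "c * cinner x y = complex_of_real (cmod (cinner x y))"
  proof (cases "cinner x y = 0")
    case False
    then show ?thesis
      by (intro that[of "cnj (cinner x y) / cmod (cinner x y)"])
        (auto simp: norm_divide complex_norm_square[symmetric] mult.commute power2_eq_square)
  qed (use that[of 1] in simp)
  have "cmod (cinner x y) = Re (cinner (c *\<^sub>C x) y)" by (simp add: cinner_scaleC_left c)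
  also have "\<dots> = inner (c *\<^sub>C x) y" by (rule Re_cinner)
  also have "\<dots> \<le> norm (c *\<^sub>C x) * norm y" by (rule norm_cauchy_schwarz)
  finally show ?thesis by (simp add: norm_scaleC c)
qed

lemma scaleR_eq_scaleC: "r *\<^sub>R x = complex_of_real r *\<^sub>C (x::'a::complex_hilbert_space)"
  by (simp add: scaleC_of_real)

lemma bounded_linear_cinner_left: "bounded_linear (\<lambda>x. cinner x (y::'a::complex_hilbert_space))"
  by (rule bounded_linear_intro[where K = "norm y"])
    (auto simp: cinner_add_left scaleR_eq_scaleC cinner_scaleC_left cmod_cinner_le scaleR_conv_of_real)

lemma bounded_linear_cinner_right: "bounded_linear (\<lambda>y. cinner x (y::'a::complex_hilbert_space))"
  using cmod_cinner_le[of x]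
  by (intro bounded_linear_intro[where K = "norm x"])
    (auto simp: cinner_add_right scaleR_eq_scaleC cinner_scaleC_right scaleR_conv_of_real mult.commute)

lemmas cinner_simps =
  cinner_add_left cinner_add_right cinner_scaleC_left cinner_scaleC_right
  linear_0[OF bounded_linear.linear[OF bounded_linear_cinner_left]]
  linear_0[OF bounded_linear.linear[OF bounded_linear_cinner_right]]
  linear_diff[OF bounded_linear.linear[OF bounded_linear_cinner_left]]
  linear_diff[OF bounded_linear.linear[OF bounded_linear_cinner_right]]
  linear_sum[OF bounded_linear.linear[OF bounded_linear_cinner_left]]
  linear_sum[OF bounded_linear.linear[OF bounded_linear_cinner_right]]

lemma cinner_eqI: "(\<And>z. cinner x z = cinner y z) \<Longrightarrow> x = (y::'a::complex_hilbert_space)"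
proof -
  assume "\<And>z. cinner x z = cinner y z"
  then have "cinner (x - y) (x - y) = 0" by (simp add: cinner_simps)
  then show ?thesis by (simp add: cinner_self)
qed

section \<open>The algebra of complex-linear operators\<close>

lemma BH_scaleC: "A \<in> BH \<Longrightarrow> blinfun_apply A (c *\<^sub>C x) = c *\<^sub>C blinfun_apply A x"
  by (simp add: BH_def)

lemma BH_compose: "A \<in> BH \<Longrightarrow> B \<in> BH \<Longrightarrow> A o\<^sub>L B \<in> BH"
  by (simp add: BH_def)

lemma BH_id: "id_blinfun \<in> BH"
  by (simp add: BH_def)

lemma op_subspace_BH: "op.subspace BH"
  by (rule BH_ideal_BH[unfolded subideal_def, THEN conjunct2, THEN conjunct1])

text \<open>An intersection of closed equalizers. It keeps the norm limit in the square root
  construction complex-linear.\<close>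

lemma closed_BH: "closed (BH :: ('a::complex_hilbert_space \<Rightarrow>\<^sub>L 'a) set)"
proof -
  have "BH = (\<Inter>c. \<Inter>x. {A :: 'a \<Rightarrow>\<^sub>L 'a. A (c *\<^sub>C x) = c *\<^sub>C A x})"
    by (auto simp: BH_def)
  moreover have "closed {A :: 'a \<Rightarrow>\<^sub>L 'a. A (c *\<^sub>C x) = c *\<^sub>C A x}" for c x
    by (intro closed_Collect_eq continuous_intros
        bounded_linear.continuous_on[OF bounded_linear_scaleC])
  ultimately show ?thesis by (metis (mono_tags, lifting) closed_INT)
qed

lemma BH_0: "0 \<in> BH"
  and BH_add: "A \<in> BH \<Longrightarrow> B \<in> BH \<Longrightarrow> A + B \<in> BH"
  and BH_diff: "A \<in> BH \<Longrightarrow> B \<in> BH \<Longrightarrow> A - B \<in> BH"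
  and BH_scale: "A \<in> BH \<Longrightarrow> scale_op c A \<in> BH"
  using op.subspace_0[OF op_subspace_BH] op.subspace_add[OF op_subspace_BH]
    op.subspace_diff[OF op_subspace_BH] op.subspace_scale[OF op_subspace_BH] by blast+

lemma BH_sum: "finite F \<Longrightarrow> (\<And>i. i \<in> F \<Longrightarrow> A i \<in> BH) \<Longrightarrow> (\<Sum>i\<in>F. A i) \<in> BH"
  by (rule op.subspace_sum[OF op_subspace_BH])

lemma scaleR_eq_scale_op: "r *\<^sub>R A = scale_op (complex_of_real r) A"
  by (rule blinfun_eqI) (simp add: scale_op.rep_eq scaleR_eq_scaleC blinfun.scaleR_left)

lemma BH_scaleR: "A \<in> BH \<Longrightarrow> r *\<^sub>R A \<in> BH"
  by (simp add: scaleR_eq_scale_op BH_scale)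

section \<open>Orthonormal systems and bases\<close>

definition orthonormal_or_zero :: "(nat \<Rightarrow> 'a::complex_hilbert_space) \<Rightarrow> bool"
  where "orthonormal_or_zero e \<longleftrightarrow>
    (\<forall>m n. m \<noteq> n \<longrightarrow> cinner (e m) (e n) = 0) \<and> (\<forall>n. e n = 0 \<or> norm (e n) = 1)"

lemma cinner_orthonormal_or_zero:
  "orthonormal_or_zero e \<Longrightarrow> cinner (e m) (e n) = (if m = n \<and> e n \<noteq> 0 then 1 else 0)"
  by (auto simp: orthonormal_or_zero_def cinner_self cinner_simps)

lemma orthonormal_or_zero_iff:
  "orthonormal_or_zero e \<longleftrightarrow> (\<forall>m n. cinner (e m) (e n) = (if m = n \<and> e n \<noteq> 0 then 1 else 0))"
proof
  assume R: "\<forall>m n. cinner (e m) (e n) = (if m = n \<and> e n \<noteq> 0 then 1 else 0)"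
  have "norm (e n) = 1" if "e n \<noteq> 0" for n
  proof -
    have "complex_of_real ((norm (e n))\<^sup>2) = 1"
      using R that cinner_self[of "e n"] by metis
    then have "(norm (e n))\<^sup>2 = 1" using of_real_eq_1_iff by blast
    then show ?thesis by (simp add: power2_eq_1_iff) (use norm_ge_zero[of "e n"] in linarith)
  qed
  with R show "orthonormal_or_zero e" by (auto simp: orthonormal_or_zero_def)
qed (simp add: cinner_orthonormal_or_zero)

text \<open>Pythagoras: the cross terms vanish. There is only an inequality because a zero vector
  \<open>e n\<close> contributes nothing on the left.\<close>

lemma norm_lincomb_le:
  assumes e: "orthonormal_or_zero e" and "finite F"
  shows "(norm (\<Sum>n\<in>F. a n *\<^sub>C e n))\<^sup>2 \<le> (\<Sum>n\<in>F. (cmod (a n))\<^sup>2)"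
proof -
  have "cinner (\<Sum>n\<in>F. a n *\<^sub>C e n) (\<Sum>n\<in>F. a n *\<^sub>C e n)
      = (\<Sum>n\<in>F. \<Sum>m\<in>F. a n * cnj (a m) * cinner (e n) (e m))"
    by (simp add: cinner_simps sum_distrib_left mult_ac) (rule sum.swap)
  also have "\<dots> = (\<Sum>n\<in>F. complex_of_real ((cmod (a n))\<^sup>2) * cinner (e n) (e n))"
  proof (rule sum.cong[OF refl])
    fix n assume n: "n \<in> F"
    have "(\<Sum>m\<in>F. a n * cnj (a m) * cinner (e n) (e m))
        = (\<Sum>m\<in>F. if n = m then a n * cnj (a n) * cinner (e n) (e n) else 0)"
      by (rule sum.cong) (auto simp: cinner_orthonormal_or_zero[OF e])
    then show "(\<Sum>m\<in>F. a n * cnj (a m) * cinner (e n) (e m))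
        = complex_of_real ((cmod (a n))\<^sup>2) * cinner (e n) (e n)"
      using n assms(2) by (simp add: complex_norm_square del: of_real_power)
  qed
  also have "\<dots> = complex_of_real (\<Sum>n\<in>F. (cmod (a n))\<^sup>2 * (norm (e n))\<^sup>2)"
    by (simp add: cinner_self)
  finally have "(norm (\<Sum>n\<in>F. a n *\<^sub>C e n))\<^sup>2 = (\<Sum>n\<in>F. (cmod (a n))\<^sup>2 * (norm (e n))\<^sup>2)"
    unfolding cinner_self of_real_eq_iff .
  also have "\<dots> \<le> (\<Sum>n\<in>F. (cmod (a n))\<^sup>2)"
  proof (rule sum_mono)
    fix n
    have "norm (e n) = 0 \<or> norm (e n) = 1" using e by (auto simp: orthonormal_or_zero_def)
    then show "(cmod (a n))\<^sup>2 * (norm (e n))\<^sup>2 \<le> (cmod (a n))\<^sup>2" by auto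
  qed
  finally show ?thesis .
qed

text \<open>Testing \<open>x\<close> against \<open>T z\<close>, where \<open>z\<close> has the
  coefficients \<open>a n\<close>, gives the sum \<open>s\<close> itself, while
  \<open>norm z\<close> is at most the root of \<open>s\<close>; a factor \<open>s\<close> then
  cancels. For the identity this is Bessel's inequality.\<close>

lemma Bessel_image:
  assumes e: "orthonormal_or_zero e" and T: "T \<in> BH" and "finite F"
  shows "(\<Sum>n\<in>F. (cmod (cinner x (blinfun_apply T (e n))))\<^sup>2) \<le> (norm T * norm x)\<^sup>2"
proof -
  define a where "a n = cinner x (blinfun_apply T (e n))" for n
  define z where "z = (\<Sum>n\<in>F. a n *\<^sub>C e n)"
  define s where "s = (\<Sum>n\<in>F. (cmod (a n))\<^sup>2)"
  have s0: "0 \<le> s" by (simp add: s_def sum_nonneg)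
  have "cinner x (blinfun_apply T z) = (\<Sum>n\<in>F. cnj (a n) * a n)"
    by (simp add: z_def blinfun.sum_right BH_scaleC[OF T] cinner_simps a_def)
  also have "\<dots> = complex_of_real s"
    by (simp add: s_def complex_norm_square mult.commute del: of_real_power)
  finally have "s = cmod (cinner x (blinfun_apply T z))" using s0 by simp
  also have "\<dots> \<le> norm x * (norm T * norm z)"
    by (meson cmod_cinner_le mult_left_mono norm_blinfun norm_ge_zero order_trans)
  finally have "s \<le> (norm T * norm x) * norm z" by (simp add: mult_ac)
  then have "s\<^sup>2 \<le> ((norm T * norm x) * norm z)\<^sup>2" using s0 by (rule power_mono)
  also have "\<dots> \<le> (norm T * norm x)\<^sup>2 * s"
    using norm_lincomb_le[OF e \<open>finite F\<close>, of a]
    by (simp add: power_mult_distrib z_def s_def mult_left_mono)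
  finally have "s * s \<le> (norm T * norm x)\<^sup>2 * s" by (simp add: power2_eq_square)
  then have "s \<le> (norm T * norm x)\<^sup>2"
    using s0 by (cases "s = 0") auto
  then show ?thesis by (simp add: s_def a_def)
qed

instance complex_hilbert_space \<subseteq> banach ..

text \<open>The operator with matrix entries read off from \<open>T\<close>: it is the adjoint of \<open>T\<close> if \<open>f = e\<close> is a
  basis, and the partial isometry mapping \<open>e n\<close> to \<open>f n\<close> if \<open>T\<close> is the identity.\<close>

lemma exists_series_operator:
  assumes e: "orthonormal_or_zero e" and f: "orthonormal_or_zero f" and T: "T \<in> BH"
  shows "\<exists>R\<in>BH. \<forall>x. (\<lambda>n. cinner x (blinfun_apply T (e n)) *\<^sub>C f n) sums blinfun_apply R x"
proof -
  define g where "g x n = cinner x (blinfun_apply T (e n)) *\<^sub>C f n" for x n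
  have part: "(norm (\<Sum>n\<in>F. g x n))\<^sup>2 \<le> (\<Sum>n\<in>F. (cmod (cinner x (blinfun_apply T (e n))))\<^sup>2)"
    if "finite F" for F x
    unfolding g_def by (rule norm_lincomb_le[OF f that])
  have sq: "summable (\<lambda>n. (cmod (cinner x (blinfun_apply T (e n))))\<^sup>2)" for x
    using Bessel_image[OF e T] by (intro bounded_imp_summable[where B = "(norm T * norm x)\<^sup>2"]) auto
  \<comment> \<open>By \<open>part\<close>, the squared norm of a block of \<open>g x\<close> is at
    most the corresponding block of the convergent series \<open>sq\<close>.\<close>
  have summ: "summable (g x)" for x
    unfolding summable_Cauchy
  proof (intro allI impI)
    fix \<epsilon> :: real assume "0 < \<epsilon>"
    then obtain N where N: "\<And>m n. m \<ge> N \<Longrightarrow>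
        norm (\<Sum>n\<in>{m..<n}. (cmod (cinner x (blinfun_apply T (e n))))\<^sup>2) < \<epsilon>\<^sup>2"
      using sq[of x] unfolding summable_Cauchy by (meson zero_less_power)
    have "norm (sum (g x) {m..<n}) < \<epsilon>" if "m \<ge> N" for m n
    proof (rule power2_less_imp_less)
      show "(norm (sum (g x) {m..<n}))\<^sup>2 < \<epsilon>\<^sup>2"
        using part[of "{m..<n}" x] N[OF that, of n] by (simp add: sum_nonneg)
    qed (use \<open>0 < \<epsilon>\<close> in simp)
    then show "\<exists>N. \<forall>m\<ge>N. \<forall>n. norm (sum (g x) {m..<n}) < \<epsilon>" by blast
  qed
  have sums: "g x sums suminf (g x)" for x using summ by (rule summable_sums)
  have "g (x + y) = (\<lambda>n. g x n + g y n)" for x y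
    by (simp add: fun_eq_iff g_def cinner_simps scaleC_add_left)
  then have add: "suminf (g (x + y)) = suminf (g x) + suminf (g y)" for x y
    using sums_add[OF sums sums, of x y] by (simp add: sums_unique[symmetric])
  have "g (c *\<^sub>C x) = (\<lambda>n. c *\<^sub>C g x n)" for c x
    by (simp add: fun_eq_iff g_def cinner_simps scaleC_scaleC)
  then have scale: "suminf (g (c *\<^sub>C x)) = c *\<^sub>C suminf (g x)" for c x
    using bounded_linear.sums[OF bounded_linear_scaleC sums, of c x]
    by (simp add: sums_unique[symmetric])
  have bound: "norm (suminf (g x)) \<le> norm x * norm T" for x
  proof (rule LIMSEQ_le_const2[OF tendsto_norm[OF sums[of x, unfolded sums_def]]])
    have "(norm (sum (g x) {..<n}))\<^sup>2 \<le> (norm T * norm x)\<^sup>2" for n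
      by (rule order_trans[OF part Bessel_image[OF e T]]) simp_all
    then have "norm (sum (g x) {..<n}) \<le> norm T * norm x" for n
      by (rule power2_le_imp_le) simp
    then have "norm (sum (g x) {..<n}) \<le> norm x * norm T" for n
      by (simp only: mult.commute)
    then show "\<exists>N. \<forall>n\<ge>N. norm (sum (g x) {..<n}) \<le> norm x * norm T" by blast
  qed
  have bl: "bounded_linear (\<lambda>x. suminf (g x))"
    by (rule bounded_linear_intro[OF add _ bound]) (simp add: scaleR_eq_scaleC scale)
  define R where "R = Blinfun (\<lambda>x. suminf (g x))"
  have R: "blinfun_apply R x = suminf (g x)" for x
    by (simp add: R_def bounded_linear_Blinfun_apply[OF bl])
  have "R \<in> BH" by (simp add: BH_def R scale)
  moreover have "g x = (\<lambda>n. cinner x (blinfun_apply T (e n)) *\<^sub>C f n)" for x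
    by (simp add: fun_eq_iff g_def)
  then have "(\<lambda>n. cinner x (blinfun_apply T (e n)) *\<^sub>C f n) sums blinfun_apply R x" for x
    using sums[of x] by (simp only: R)
  ultimately show ?thesis by blast
qed

text \<open>As \<open>sgn 0 = 0\<close>, vectors that depend linearly on their predecessors are sent to \<open>0\<close>; this is
  why zeros are allowed in \<^const>\<open>orthonormal_or_zero\<close>.\<close>

function gram_schmidt :: "(nat \<Rightarrow> 'a::complex_hilbert_space) \<Rightarrow> nat \<Rightarrow> 'a" where
  "gram_schmidt d n = sgn (d n - (\<Sum>i<n. cinner (d n) (gram_schmidt d i) *\<^sub>C gram_schmidt d i))"
  by auto
termination by (relation "Wellfounded.measure snd") auto

declare gram_schmidt.simps [simp del]

lemma sgn_eq_scaleC: "sgn x = complex_of_real (inverse (norm x)) *\<^sub>C (x::'a::complex_hilbert_space)"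
  by (simp add: sgn_div_norm scaleR_eq_scaleC)

lemma orthonormal_or_zero_gram_schmidt: "orthonormal_or_zero (gram_schmidt d)"
proof -
  let ?e = "gram_schmidt d"
  have n1: "?e n = 0 \<or> norm (?e n) = 1" for n
    by (subst (1 2) gram_schmidt.simps) (auto simp: norm_sgn)
  have orth: "\<forall>m<n. cinner (?e n) (?e m) = 0" for n
  proof (induction n rule: less_induct)
    case (less n)
    have z: "cinner (?e i) (?e m) = 0" if "i \<noteq> m" "i < n" "m < n" for i m
      using less.IH[OF that(2)] less.IH[OF that(3)] that(1) cinner_commute[of "?e i" "?e m"]
      by (metis complex_cnj_zero linorder_neqE_nat)
    show ?case
    proof (intro allI impI)
      fix m assume m: "m < n"
      have "(\<Sum>i<n. cinner (d n) (?e i) * cinner (?e i) (?e m))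
          = (\<Sum>i<n. if i = m then cinner (d n) (?e m) * cinner (?e m) (?e m) else 0)"
        using z m by (intro sum.cong) auto
      also have "\<dots> = cinner (d n) (?e m) * cinner (?e m) (?e m)" using m by simp
      also have "\<dots> = cinner (d n) (?e m)"
        using n1[of m] by (auto simp: cinner_self cinner_simps)
      finally have "cinner (d n - (\<Sum>i<n. cinner (d n) (?e i) *\<^sub>C ?e i)) (?e m) = 0"
        by (simp add: cinner_simps)
      then show "cinner (?e n) (?e m) = 0"
        by (subst gram_schmidt.simps) (simp add: sgn_eq_scaleC cinner_simps)
    qed
  qed
  have "cinner (?e m) (?e n) = 0" if "m \<noteq> n" for m n
    using that orth[of m] orth[of n] cinner_commute[of "?e m" "?e n"]
    by (metis complex_cnj_zero linorder_neqE_nat)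
  with n1 show ?thesis by (auto simp: orthonormal_or_zero_def)
qed

lemma gram_schmidt_in_span: "gram_schmidt d n \<in> cvec.span (range d)"
proof (induction n rule: less_induct)
  case (less n)
  show ?case
    unfolding gram_schmidt.simps[of d n] sgn_eq_scaleC
    by (intro cvec.span_scale cvec.span_diff cvec.span_sum cvec.span_base[OF rangeI] less) simp
qed

lemma in_span_gram_schmidt: "d n \<in> cvec.span (range (gram_schmidt d))"
proof -
  let ?y = "d n - (\<Sum>i<n. cinner (d n) (gram_schmidt d i) *\<^sub>C gram_schmidt d i)"
  \<comment> \<open>For \<open>?y = 0\<close> both sides vanish; otherwise multiplying by the norm
    undoes \<open>sgn\<close>.\<close>
  have "?y = complex_of_real (norm ?y) *\<^sub>C gram_schmidt d n"
    by (subst (2) gram_schmidt.simps)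
      (cases "?y = 0", simp_all add: sgn_div_norm scaleR_eq_scaleC[symmetric])
  then have "d n = complex_of_real (norm ?y) *\<^sub>C gram_schmidt d n
      + (\<Sum>i<n. cinner (d n) (gram_schmidt d i) *\<^sub>C gram_schmidt d i)"
    by (metis diff_add_cancel)
  also have "\<dots> \<in> cvec.span (range (gram_schmidt d))"
    by (intro cvec.span_scale cvec.span_add cvec.span_sum cvec.span_base[OF rangeI])
  finally show ?thesis .
qed

definition orthonormal_basis :: "(nat \<Rightarrow> 'a::complex_hilbert_space) \<Rightarrow> bool"
  where "orthonormal_basis e \<longleftrightarrow>
    orthonormal_or_zero e \<and> (\<forall>n. e n \<noteq> 0) \<and> (\<forall>x. (\<lambda>n. cinner x (e n) *\<^sub>C e n) sums x)"

lemma BH_eqI: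
  assumes e: "orthonormal_basis e" and A: "A \<in> BH" and B: "B \<in> BH"
    and eq: "\<And>n. blinfun_apply A (e n) = blinfun_apply B (e n)"
  shows "A = B"
proof (rule blinfun_eqI)
  fix x
  have s: "(\<lambda>n. cinner x (e n) *\<^sub>C e n) sums x" using e by (simp add: orthonormal_basis_def)
  have "(\<lambda>n. cinner x (e n) *\<^sub>C blinfun_apply A (e n)) sums blinfun_apply A x"
    using bounded_linear.sums[OF blinfun.bounded_linear_right[of A] s]
    by (simp add: BH_scaleC[OF A])
  moreover have "(\<lambda>n. cinner x (e n) *\<^sub>C blinfun_apply B (e n)) sums blinfun_apply B x"
    using bounded_linear.sums[OF blinfun.bounded_linear_right[of B] s]
    by (simp add: BH_scaleC[OF B])
  ultimately show "blinfun_apply A x = blinfun_apply B x" using eq by (simp add: sums_unique2)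
qed

lemma subspace_eq_on_BH:
  assumes "A \<in> BH" "B \<in> BH"
  shows "cvec.subspace {x. blinfun_apply A x = blinfun_apply B x}"
  unfolding cvec.subspace_def
  by (simp add: blinfun.add_right blinfun.zero_right BH_scaleC assms)

lemma closed_eq_blinfun:
  "closed {x. blinfun_apply A x = blinfun_apply B x}"
  by (intro closed_Collect_eq continuous_intros)

text \<open>Gram-Schmidt is run on a dense sequence. The expansion operator \<open>R\<close> fixes
  every \<open>g k\<close>, so its closed space of fixed points contains \<open>D\<close> and is
  everything. Infinitely many \<open>g n\<close> are nonzero, since otherwise finitely many vectors
  would span.\<close>

lemma exists_orthonormal_basis:
  assumes "\<exists>D::'a::complex_hilbert_space set. countable D \<and> closure D = UNIV"
    and fin: "\<nexists>B::'a set. finite B \<and> cvec.span B = UNIV"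
  shows "\<exists>e::nat \<Rightarrow> 'a. orthonormal_basis e"
proof -
  obtain D :: "'a set" where D: "countable D" "closure D = UNIV" using assms(1) by blast
  define g where "g = gram_schmidt (from_nat_into D)"
  have g: "orthonormal_or_zero g" unfolding g_def by (rule orthonormal_or_zero_gram_schmidt)
  obtain R where R: "R \<in> BH" and Rs: "\<And>x. (\<lambda>n. cinner x (g n) *\<^sub>C g n) sums blinfun_apply R x"
    using exists_series_operator[OF g g BH_id] by auto
  have "(\<lambda>n. cinner (g k) (g n) *\<^sub>C g n) sums g k" for k
  proof -
    have "(\<lambda>n. cinner (g k) (g n) *\<^sub>C g n) = (\<lambda>n. if n = k then g n else 0)"
      by (auto simp: cinner_orthonormal_or_zero[OF g])
    then show ?thesis using sums_single[of k g] by simp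
  qed
  then have Rg: "blinfun_apply R (g k) = blinfun_apply id_blinfun (g k)" for k
    using Rs[of "g k"] by (simp add: sums_unique2)
  have "cvec.span (range g) \<subseteq> {x. blinfun_apply R x = blinfun_apply id_blinfun x}"
    using Rg by (intro cvec.span_minimal subspace_eq_on_BH R BH_id) auto
  moreover have "D \<subseteq> cvec.span (range g)"
    using in_span_gram_schmidt[of "from_nat_into D"] from_nat_into_surj[OF D(1)]
    unfolding g_def by (metis subsetI)
  ultimately have "closure D \<subseteq> {x. blinfun_apply R x = blinfun_apply id_blinfun x}"
    by (intro closure_minimal closed_eq_blinfun) auto
  then have Rid: "blinfun_apply R x = x" for x using D(2) by auto
  define N where "N = {n. g n \<noteq> 0}"
  have inf: "infinite N"
  proof
    assume f: "finite N"
    have "x \<in> cvec.span (g ` N)" for x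
    proof -
      have "(\<lambda>n. cinner x (g n) *\<^sub>C g n) sums (\<Sum>n\<in>N. cinner x (g n) *\<^sub>C g n)"
        by (rule sums_finite[OF f]) (simp add: N_def)
      then have "x = (\<Sum>n\<in>N. cinner x (g n) *\<^sub>C g n)" using Rs[of x] Rid by (simp add: sums_unique2)
      also have "\<dots> \<in> cvec.span (g ` N)"
        by (intro cvec.span_sum cvec.span_scale cvec.span_base imageI)
      finally show ?thesis .
    qed
    then show False using fin f by blast
  qed
  \<comment> \<open>Listing the nonzero vectors in increasing order of index drops only zero terms
    from the expansions.\<close>
  define e where "e = g \<circ> enumerate N"
  have mono: "strict_mono (enumerate N)" using inf by (simp add: strict_mono_enumerate)
  have ran: "range (enumerate N) = N" using inf by (simp add: range_enumerate)
  have "(\<lambda>n. cinner x (e n) *\<^sub>C e n) sums x" for x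
    unfolding e_def comp_def
    by (subst sums_mono_reindex[OF mono, of "\<lambda>n. cinner x (g n) *\<^sub>C g n"])
      (use Rs[of x] Rid ran in \<open>auto simp: N_def\<close>)
  moreover have "e n \<noteq> 0" for n using ran by (auto simp: e_def N_def)
  moreover have "orthonormal_or_zero e"
    using g strict_mono_eq[OF mono]
    by (auto simp: orthonormal_or_zero_def e_def)
  ultimately show ?thesis by (auto simp: orthonormal_basis_def)
qed

section \<open>Adjoints, square roots and polar decomposition\<close>

definition adjoint_pair ::
    "('a::complex_hilbert_space \<Rightarrow>\<^sub>L 'a) \<Rightarrow> ('a \<Rightarrow>\<^sub>L 'a) \<Rightarrow> bool"
  where "adjoint_pair T T' \<longleftrightarrow>
    (\<forall>x y. cinner (blinfun_apply T x) y = cinner x (blinfun_apply T' y))"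

lemma adjoint_pair_commute: "adjoint_pair T T' \<Longrightarrow> adjoint_pair T' T"
  unfolding adjoint_pair_def by (metis cinner_commute)

lemma adjoint_pair_compose:
  "adjoint_pair S S' \<Longrightarrow> adjoint_pair T T' \<Longrightarrow> adjoint_pair (S o\<^sub>L T) (T' o\<^sub>L S')"
  by (simp add: adjoint_pair_def)

lemma adjoint_pair_scaleR:
  "adjoint_pair T T' \<Longrightarrow> adjoint_pair (r *\<^sub>R T) (r *\<^sub>R T')"
  by (simp add: adjoint_pair_def blinfun.scaleR_left scaleR_eq_scaleC cinner_simps)

lemma adjoint_pair_unique:
  assumes "adjoint_pair T S" "adjoint_pair T S'"
  shows "S = S'"
  using assms by (intro blinfun_eqI cinner_eqI) (metis adjoint_pair_def adjoint_pair_commute)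

text \<open>For \<open>z = T' y\<close>, the square of \<open>norm z\<close> is
  \<open>cinner (T z) y\<close>, hence at most \<open>norm T * norm z * norm y\<close>; a factor
  \<open>norm z\<close> cancels.\<close>

lemma norm_adjoint_le:
  assumes "adjoint_pair T T'"
  shows "norm T' \<le> norm T"
proof (rule norm_blinfun_bound)
  fix y
  let ?z = "blinfun_apply T' y"
  have "norm ?z * norm ?z = cmod (cinner ?z ?z)" by (simp add: cinner_self norm_mult power2_eq_square)
  also have "cinner ?z ?z = cinner (blinfun_apply T ?z) y" using assms by (simp add: adjoint_pair_def)
  also have "cmod \<dots> \<le> norm (blinfun_apply T ?z) * norm y" by (rule cmod_cinner_le)
  also have "\<dots> \<le> (norm T * norm ?z) * norm y" by (intro mult_right_mono norm_blinfun) simp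
  finally show "norm ?z \<le> norm T * norm y" by (cases "?z = 0") (auto simp: mult_ac)
qed simp

text \<open>The candidate has the coordinates \<open>cinner y (T (e n))\<close>. Expanding
  \<open>x\<close> on one side and \<open>R y\<close> on the other yields the same scalar
  series.\<close>

lemma exists_adjoint:
  fixes e :: "nat \<Rightarrow> 'a::complex_hilbert_space" and T :: "'a \<Rightarrow>\<^sub>L 'a"
  assumes e: "orthonormal_basis e" and T: "T \<in> BH"
  shows "\<exists>T'\<in>BH. adjoint_pair T T'"
proof -
  have e': "orthonormal_or_zero e" and ex: "\<And>x. (\<lambda>n. cinner x (e n) *\<^sub>C e n) sums x"
    using e by (auto simp: orthonormal_basis_def)
  obtain R where R: "R \<in> BH"
    "\<And>y. (\<lambda>n. cinner y (blinfun_apply T (e n)) *\<^sub>C e n) sums blinfun_apply R y"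
    using exists_series_operator[OF e' e' T] by blast
  have "cinner (blinfun_apply T x) y = cinner x (blinfun_apply R y)" for x y
  proof (rule sums_unique2)
    show "(\<lambda>n. cinner (blinfun_apply T (e n)) y * cinner x (e n)) sums cinner (blinfun_apply T x) y"
      using bounded_linear.sums[OF bounded_linear_cinner_left
          bounded_linear.sums[OF blinfun.bounded_linear_right[of T] ex[of x]], of y]
      by (simp add: BH_scaleC[OF T] cinner_simps mult.commute)
    show "(\<lambda>n. cinner (blinfun_apply T (e n)) y * cinner x (e n)) sums cinner x (blinfun_apply R y)"
      using bounded_linear.sums[OF bounded_linear_cinner_right R(2)[of y], of x]
      by (simp add: cinner_simps cinner_commute[of "blinfun_apply T _" y, symmetric])
  qed
  with R(1) show ?thesis by (auto simp: adjoint_pair_def)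
qed

text \<open>The square root of \<open>T\<^sup>* T = 1 - A\<close> is \<open>1 - L\<close>, where \<open>L = (A + L\<^sup>2) / 2\<close> is the limit of the
  iteration \<open>Y \<mapsto> (A + Y\<^sup>2) / 2\<close>; this is dominated by the scalar iteration for \<open>A = 1\<close>.\<close>

lemma exists_self_adjoint_sqrt:
  assumes T: "T \<in> BH" "T' \<in> BH" and adj: "adjoint_pair T T'" and nT: "norm T \<le> 1"
  shows "\<exists>S\<in>BH. adjoint_pair S S \<and> S o\<^sub>L S = T' o\<^sub>L T"
proof -
  define A where "A = id_blinfun - (T' o\<^sub>L T)"
  have A: "A \<in> BH" unfolding A_def using T by (intro BH_diff BH_id BH_compose)
  have adjA: "adjoint_pair A A"
    using adj adjoint_pair_commute[OF adj]
    by (simp add: A_def adjoint_pair_def blinfun.diff_left cinner_simps)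
  \<comment> \<open>Expanding the square of \<open>norm (x - T' (T x))\<close> produces the cross
    term \<open>- 2 * (norm (T x))^2\<close>, which outweighs the term
    \<open>(norm (T' (T x)))^2\<close> because \<open>T'\<close> is a contraction.\<close>
  have nA: "norm A \<le> 1"
  proof (rule norm_blinfun_bound)
    fix x
    let ?p = "blinfun_apply T' (blinfun_apply T x)"
    have "norm ?p \<le> norm T' * norm (blinfun_apply T x)" by (rule norm_blinfun)
    also have "\<dots> \<le> 1 * norm (blinfun_apply T x)"
      using norm_adjoint_le[OF adj] nT by (intro mult_right_mono) auto
    finally have p: "(norm ?p)\<^sup>2 \<le> (norm (blinfun_apply T x))\<^sup>2" by (simp add: power_mono)
    have "cinner x ?p = cinner (blinfun_apply T x) (blinfun_apply T x)"
      using adj by (simp add: adjoint_pair_def)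
    then have "inner x ?p = (norm (blinfun_apply T x))\<^sup>2"
      by (metis Re_cinner power2_norm_eq_inner)
    then have "(norm (x - ?p))\<^sup>2 = (norm x)\<^sup>2 + (norm ?p)\<^sup>2 - 2 * (norm (blinfun_apply T x))\<^sup>2"
      by (simp add: power2_norm_eq_inner inner_diff_left inner_diff_right inner_commute)
    with p have "(norm (x - ?p))\<^sup>2 \<le> (norm x)\<^sup>2" by (smt (verit) zero_le_power2)
    then show "norm (blinfun_apply A x) \<le> 1 * norm x"
      by (simp add: A_def blinfun.diff_left)
  qed simp
  define Y where "Y = rec_nat (0 :: 'a \<Rightarrow>\<^sub>L 'a) (\<lambda>n X. (1/2) *\<^sub>R (A + (X o\<^sub>L X)))"
  \<comment> \<open>The scalar majorant: it increases within the unit interval, and its increments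
    dominate those of \<open>Y\<close> in norm.\<close>
  define y where "y = rec_nat (0::real) (\<lambda>n x. (1 + x * x) / 2)"
  have Y: "Y 0 = 0" "\<And>n. Y (Suc n) = (1/2) *\<^sub>R (A + (Y n o\<^sub>L Y n))" by (simp_all add: Y_def)
  have y: "y 0 = 0" "\<And>n. y (Suc n) = (1 + y n * y n) / 2" by (simp_all add: y_def)
  have y01: "0 \<le> y n \<and> y n \<le> 1" for n
    by (induction n) (auto simp: y mult_le_one)
  have ymono: "y n \<le> y (Suc n)" for n
  proof -
    have "y (Suc n) - y n = (1 - y n)\<^sup>2 / 2" by (simp add: y power2_eq_square field_simps)
    then show ?thesis by (smt (verit) zero_le_power2 divide_nonneg_pos)
  qed
  have nY: "norm (Y n) \<le> y n" for n
  proof (induction n)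
    case (Suc n)
    have "norm (Y n o\<^sub>L Y n) \<le> y n * y n"
      using norm_blinfun_compose[of "Y n" "Y n"] Suc y01[of n]
      by (meson mult_mono norm_ge_zero order_trans)
    then have "norm (A + (Y n o\<^sub>L Y n)) \<le> 1 + y n * y n"
      using nA by (intro norm_triangle_mono)
    then show ?case by (simp add: Y y)
  qed (simp add: Y y)
  have dY: "norm (Y (Suc n) - Y n) \<le> y (Suc n) - y n" for n
  proof (induction n)
    case 0
    then show ?case using nA by (simp add: Y y)
  next
    case (Suc n)
    let ?U = "Y (Suc n)" and ?V = "Y n"
    \<comment> \<open>\<open>A\<close> cancels, and the difference of squares is split without
      commuting \<open>?U\<close> and \<open>?V\<close>.\<close>
    have eq: "Y (Suc (Suc n)) - ?U = (1/2) *\<^sub>R ((?U o\<^sub>L (?U - ?V)) + ((?U - ?V) o\<^sub>L ?V))"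
      by (rule blinfun_eqI) (simp add: Y(2)[of "Suc n"] Y(2)[of n] blinfun.bilinear_simps algebra_simps)
    have l: "norm (?U o\<^sub>L (?U - ?V)) \<le> y (Suc n) * (y (Suc n) - y n)"
      using norm_blinfun_compose[of ?U "?U - ?V"] nY[of "Suc n"] Suc y01[of "Suc n"]
      by (meson mult_mono norm_ge_zero order_trans)
    have r: "norm ((?U - ?V) o\<^sub>L ?V) \<le> (y (Suc n) - y n) * y n"
      using norm_blinfun_compose[of "?U - ?V" ?V] nY[of n] Suc ymono[of n]
      by (smt (verit) mult_mono norm_ge_zero)
    have "norm (Y (Suc (Suc n)) - ?U)
        \<le> (y (Suc n) * (y (Suc n) - y n) + (y (Suc n) - y n) * y n) / 2"
      using norm_triangle_mono[OF l r] by (simp add: eq)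
    also have "\<dots> = y (Suc (Suc n)) - y (Suc n)"
      by (simp add: y(2)[of "Suc n"] y(2)[of n] field_simps)
    finally show ?case .
  qed
  have "convergent y"
    using y01 ymono by (intro Bseq_monoseq_convergent BseqI'[where K = 1]) (auto simp: monoseq_Suc)
  \<comment> \<open>The increments of a convergent scalar sequence telescope, which gives the
    summable majorant for the increments of \<open>Y\<close>.\<close>
  then have "summable (\<lambda>n. y (Suc n) - y n)"
    by (auto simp: convergent_def dest: telescope_summable)
  then have "summable (\<lambda>n. Y (Suc n) - Y n)"
    by (rule summable_comparison_test[rotated]) (use dY in blast)
  then obtain l where "(\<lambda>n. \<Sum>k<n. Y (Suc k) - Y k) \<longlonglongrightarrow> l"
    by (auto simp: summable_def sums_def)
  then obtain L where L: "Y \<longlonglongrightarrow> L" by (auto simp: sum_lessThan_telescope Y(1))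
  have YBH: "Y n \<in> BH" for n
    by (induction n) (auto simp: Y intro!: BH_0 BH_scaleR BH_add A BH_compose)
  have LBH: "L \<in> BH" using closed_sequentially[OF closed_BH YBH L] .
  have adjY: "adjoint_pair (Y n) (Y n)" for n
  proof (induction n)
    case (Suc n)
    then show ?case
      using adjA by (simp add: Y adjoint_pair_def blinfun.bilinear_simps scaleR_eq_scaleC cinner_simps)
  qed (simp add: Y adjoint_pair_def cinner_simps)
  have adjL: "adjoint_pair L L"
    unfolding adjoint_pair_def
  proof (intro allI LIMSEQ_unique)
    fix x y
    show "(\<lambda>n. cinner (blinfun_apply (Y n) x) y) \<longlonglongrightarrow> cinner (blinfun_apply L x) y"
      by (intro bounded_linear.tendsto[OF bounded_linear_cinner_left] blinfun.tendsto L tendsto_const)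
    have "(\<lambda>n. cinner x (blinfun_apply (Y n) y)) \<longlonglongrightarrow> cinner x (blinfun_apply L y)"
      by (intro bounded_linear.tendsto[OF bounded_linear_cinner_right] blinfun.tendsto L tendsto_const)
    then show "(\<lambda>n. cinner (blinfun_apply (Y n) x) y) \<longlonglongrightarrow> cinner x (blinfun_apply L y)"
      using adjY by (simp add: adjoint_pair_def)
  qed
  have "(\<lambda>n. (1/2) *\<^sub>R (A + (Y n o\<^sub>L Y n))) \<longlonglongrightarrow> (1/2) *\<^sub>R (A + (L o\<^sub>L L))"
    by (intro tendsto_intros bounded_bilinear.tendsto[OF bounded_bilinear_blinfun_compose] L)
  then have "(\<lambda>n. Y (Suc n)) \<longlonglongrightarrow> (1/2) *\<^sub>R (A + (L o\<^sub>L L))" by (simp add: Y)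
  then have fixL: "L = (1/2) *\<^sub>R (A + (L o\<^sub>L L))"
    using LIMSEQ_Suc[OF L] by (rule LIMSEQ_unique[symmetric])
  have LL: "L o\<^sub>L L = 2 *\<^sub>R L - A"
    using arg_cong[OF fixL, of "\<lambda>X. 2 *\<^sub>R X"] by (simp add: algebra_simps)
  define S where "S = id_blinfun - L"
  have "S o\<^sub>L S = id_blinfun - 2 *\<^sub>R L + (L o\<^sub>L L)"
    by (rule blinfun_eqI) (simp add: S_def blinfun.bilinear_simps algebra_simps scaleR_2)
  also have "\<dots> = T' o\<^sub>L T" unfolding LL by (simp add: A_def)
  finally have "S o\<^sub>L S = T' o\<^sub>L T" .
  moreover have "S \<in> BH" unfolding S_def by (intro BH_diff BH_id LBH)
  moreover have "adjoint_pair S S"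
    using adjL by (simp add: S_def adjoint_pair_def blinfun.diff_left cinner_simps)
  ultimately show ?thesis by blast
qed

text \<open>\<open>U\<close> and \<open>R\<close> are series operators with the roles of
  \<open>e\<close> and \<open>f\<close> exchanged; their pairings with two vectors have the same
  terms. The last clause, that \<open>R\<close> kills the complement of the \<open>f n\<close>,
  serves the almost disjoint isometries.\<close>

lemma exists_partial_isometry:
  fixes e f :: "nat \<Rightarrow> 'a::complex_hilbert_space"
  assumes e: "orthonormal_or_zero e" and f: "orthonormal_or_zero f"
    and zero: "\<And>n. f n = 0 \<longleftrightarrow> e n = 0"
  shows "\<exists>U\<in>BH. \<exists>R\<in>BH. adjoint_pair U R \<and> (\<forall>n. blinfun_apply U (e n) = f n) \<and>
    (\<forall>n. blinfun_apply R (f n) = e n) \<and>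
    (\<forall>x. (\<forall>n. cinner x (f n) = 0) \<longrightarrow> blinfun_apply R x = 0)"
proof -
  obtain U where U: "U \<in> BH" and Us: "\<And>x. (\<lambda>n. cinner x (e n) *\<^sub>C f n) sums blinfun_apply U x"
    using exists_series_operator[OF e f BH_id] by auto
  obtain R where R: "R \<in> BH" and Rs: "\<And>x. (\<lambda>n. cinner x (f n) *\<^sub>C e n) sums blinfun_apply R x"
    using exists_series_operator[OF f e BH_id] by auto
  have Ue: "blinfun_apply U (e k) = f k" for k
  proof -
    \<comment> \<open>If \<open>e k = 0\<close>, the left side is the zero sequence, and
      \<open>zero\<close> makes the right side vanish too.\<close>
    have "(\<lambda>n. cinner (e k) (e n) *\<^sub>C f n) = (\<lambda>n. if n = k then f n else 0)"
      using zero by (auto simp: cinner_orthonormal_or_zero[OF e])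
    then show ?thesis using sums_single[of k f] Us[of "e k"] by (simp add: sums_unique2)
  qed
  have Rf: "blinfun_apply R (f k) = e k" for k
  proof -
    have "(\<lambda>n. cinner (f k) (f n) *\<^sub>C e n) = (\<lambda>n. if n = k then e n else 0)"
      using zero by (auto simp: cinner_orthonormal_or_zero[OF f])
    then show ?thesis using sums_single[of k e] Rs[of "f k"] by (simp add: sums_unique2)
  qed
  have "adjoint_pair U R"
    unfolding adjoint_pair_def
  proof (intro allI sums_unique2)
    fix x z
    show "(\<lambda>n. cinner x (e n) * cinner (f n) z) sums cinner (blinfun_apply U x) z"
      using bounded_linear.sums[OF bounded_linear_cinner_left Us[of x], of z]
      by (simp add: cinner_simps)
    show "(\<lambda>n. cinner x (e n) * cinner (f n) z) sums cinner x (blinfun_apply R z)"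
      using bounded_linear.sums[OF bounded_linear_cinner_right Rs[of z], of x]
      by (simp add: cinner_simps cinner_commute[of "f _" z, symmetric] mult.commute)
  qed
  moreover have "blinfun_apply R x = 0" if "\<forall>n. cinner x (f n) = 0" for x
    using sums_unique2[OF sums_zero, of "blinfun_apply R x"] Rs[of x] that by simp
  ultimately show ?thesis using U R Ue Rf by blast
qed

text \<open>With the polar decomposition \<open>T = U S\<close>, \<open>S = U\<^sup>* T\<close>, \<open>S\<^sup>2 = T\<^sup>* T\<close>, the factorization is
  \<open>T\<^sup>* = S U\<^sup>* = U\<^sup>* T U\<^sup>*\<close>. Running Gram--Schmidt on a dense sequence in the range of \<open>S\<close> gives an
  orthonormal system \<open>e n = S (y n)\<close>; then \<open>f n = T (y n)\<close> is orthonormal too and \<open>U\<close> maps \<open>e n\<close>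
  to \<open>f n\<close>.\<close>

lemma adjoint_factorization_contraction:
  assumes sep: "\<exists>D::'a::complex_hilbert_space set. countable D \<and> closure D = UNIV"
    and T: "T \<in> BH" "T' \<in> BH" and adj: "adjoint_pair T T'" and nT: "norm (T :: 'a \<Rightarrow>\<^sub>L 'a) \<le> 1"
  shows "\<exists>R\<in>BH. T' = R o\<^sub>L T o\<^sub>L R"
proof -
  obtain S where S: "S \<in> BH" and adjS: "adjoint_pair S S" and SS: "S o\<^sub>L S = T' o\<^sub>L T"
    using exists_self_adjoint_sqrt[OF T adj nT] by blast
  have ST: "cinner (blinfun_apply S x) (blinfun_apply S z)
      = cinner (blinfun_apply T x) (blinfun_apply T z)" for x z
  proof -
    have "cinner (blinfun_apply S x) (blinfun_apply S z) = cinner x (blinfun_apply (S o\<^sub>L S) z)"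
      using adjS by (simp add: adjoint_pair_def)
    also have "\<dots> = cinner (blinfun_apply T x) (blinfun_apply T z)"
      using adj by (simp add: SS adjoint_pair_def)
    finally show ?thesis .
  qed
  \<comment> \<open>So \<open>T w\<close> depends only on \<open>S w\<close>, and
    \<open>S w \<mapsto> T w\<close> is a well-defined isometry on the range of
    \<open>S\<close>.\<close>
  have ker: "blinfun_apply T x = blinfun_apply T z" if "blinfun_apply S x = blinfun_apply S z" for x z
  proof -
    have "cinner (blinfun_apply T (x - z)) (blinfun_apply T (x - z)) = 0"
      using that by (simp add: ST[symmetric] blinfun.diff_right cinner_simps)
    then show ?thesis by (simp add: cinner_self blinfun.diff_right)
  qed
  obtain D :: "'a set" where D: "countable D" "closure D = UNIV" using sep by blast
  define d where "d n = blinfun_apply S (from_nat_into D n)" for n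
  define e where "e = gram_schmidt d"
  have e: "orthonormal_or_zero e" unfolding e_def by (rule orthonormal_or_zero_gram_schmidt)
  have "cvec.subspace (range (blinfun_apply S))"
    unfolding cvec.subspace_def
    by (auto simp: image_iff)
      (metis blinfun.zero_right blinfun.add_right BH_scaleC[OF S])+
  then have "cvec.span (range d) \<subseteq> range (blinfun_apply S)"
    by (intro cvec.span_minimal) (auto simp: d_def)
  then have "\<exists>y. e n = blinfun_apply S y" for n
    using gram_schmidt_in_span[of d n] by (auto simp: e_def)
  then obtain y where y: "\<And>n. e n = blinfun_apply S (y n)" by metis
  define f where "f n = blinfun_apply T (y n)" for n
  have ef: "cinner (f m) (f n) = cinner (e m) (e n)" for m n by (simp add: f_def y ST)
  have "(norm (f n))\<^sup>2 = (norm (e n))\<^sup>2" for n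
    using ef[of n n] by (simp only: cinner_self of_real_eq_iff)
  then have zero: "f n = 0 \<longleftrightarrow> e n = 0" for n
    by (metis norm_eq_zero power_eq_0_iff zero_power2)
  have f: "orthonormal_or_zero f"
    unfolding orthonormal_or_zero_iff using zero by (simp add: ef cinner_orthonormal_or_zero[OF e])
  obtain U R where U: "U \<in> BH" and R: "R \<in> BH" and adjUR: "adjoint_pair U R"
    and Ue: "\<And>n. blinfun_apply U (e n) = f n" and Rf: "\<And>n. blinfun_apply R (f n) = e n"
    using exists_partial_isometry[OF e f zero] by metis
  \<comment> \<open>The relations \<open>U (S w) = T w\<close> and \<open>R (T w) = S w\<close> are
    required for some preimage \<open>w\<close> of \<open>v\<close>. They are linear, so they pass
    from the \<open>e n\<close> to their span, which contains every \<open>d n\<close>.\<close>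
  let ?M = "{v. \<exists>w. blinfun_apply S w = v \<and> blinfun_apply U v = blinfun_apply T w
      \<and> blinfun_apply R (blinfun_apply T w) = v}"
  have "cvec.subspace ?M"
    unfolding cvec.subspace_def
  proof (intro conjI ballI allI)
    show "0 \<in> ?M" by (auto intro!: exI[of _ 0] simp: blinfun.zero_right)
    show "v + v' \<in> ?M" if v: "v \<in> ?M" "v' \<in> ?M" for v v'
    proof -
      obtain w w' where "blinfun_apply S w = v \<and> blinfun_apply U v = blinfun_apply T w
          \<and> blinfun_apply R (blinfun_apply T w) = v"
        "blinfun_apply S w' = v' \<and> blinfun_apply U v' = blinfun_apply T w'
          \<and> blinfun_apply R (blinfun_apply T w') = v'" using v by blast
      then have "blinfun_apply S (w + w') = v + v' \<and> blinfun_apply U (v + v') = blinfun_apply T (w + w')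
          \<and> blinfun_apply R (blinfun_apply T (w + w')) = v + v'"
        by (simp add: blinfun.add_right)
      then show ?thesis by blast
    qed
    show "c *\<^sub>C v \<in> ?M" if v: "v \<in> ?M" for c v
    proof -
      obtain w where "blinfun_apply S w = v \<and> blinfun_apply U v = blinfun_apply T w
          \<and> blinfun_apply R (blinfun_apply T w) = v" using v by blast
      then have "blinfun_apply S (c *\<^sub>C w) = c *\<^sub>C v \<and> blinfun_apply U (c *\<^sub>C v) = blinfun_apply T (c *\<^sub>C w)
          \<and> blinfun_apply R (blinfun_apply T (c *\<^sub>C w)) = c *\<^sub>C v"
        by (simp add: BH_scaleC[OF S] BH_scaleC[OF U] BH_scaleC[OF T(1)]
            BH_scaleC[OF R])
      then show ?thesis by blast
    qed
  qed
  moreover have "range e \<subseteq> ?M" using Ue Rf y by (auto simp: f_def)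
  ultimately have "cvec.span (range e) \<subseteq> ?M" by (rule cvec.span_minimal[rotated])
  then have dM: "d n \<in> ?M" for n using in_span_gram_schmidt[of d n] by (auto simp: e_def)
  have onD: "blinfun_apply (U o\<^sub>L S) x = blinfun_apply T x \<and> blinfun_apply (R o\<^sub>L T) x = blinfun_apply S x"
    if xD: "x \<in> D" for x
  proof -
    obtain n where "from_nat_into D n = x" using from_nat_into_surj[OF D(1) xD] by blast
    then have "d n = blinfun_apply S x" by (simp add: d_def)
    with dM[of n] obtain w where "blinfun_apply S w = blinfun_apply S x"
      "blinfun_apply U (blinfun_apply S x) = blinfun_apply T w"
      "blinfun_apply R (blinfun_apply T w) = blinfun_apply S x" by auto
    \<comment> \<open>The witness \<open>w\<close> need not be \<open>x\<close>, but
      \<open>S w = S x\<close> forces \<open>T w = T x\<close>.\<close>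
    with ker[of w x] show ?thesis by simp
  qed
  have "closure D \<subseteq> {x. blinfun_apply (U o\<^sub>L S) x = blinfun_apply T x}"
    using onD by (intro closure_minimal closed_eq_blinfun) auto
  then have US: "U o\<^sub>L S = T" using D(2) by (intro blinfun_eqI) auto
  have "closure D \<subseteq> {x. blinfun_apply (R o\<^sub>L T) x = blinfun_apply S x}"
    using onD by (intro closure_minimal closed_eq_blinfun) auto
  then have RT: "R o\<^sub>L T = S" using D(2) by (intro blinfun_eqI) auto
  \<comment> \<open>Taking adjoints in \<open>T = U o\<^sub>L S\<close> gives
    \<open>T' = S o\<^sub>L R\<close>, into which \<open>S = R o\<^sub>L T\<close> is
    inserted.\<close>
  have "adjoint_pair T (S o\<^sub>L R)" using adjoint_pair_compose[OF adjUR adjS] by (simp add: US)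
  then have "T' = R o\<^sub>L T o\<^sub>L R" using adjoint_pair_unique[OF adj] RT by simp
  then show ?thesis using R by blast
qed

text \<open>The identity is linear in \<open>T\<close> for fixed \<open>R\<close>, so rescaling to a
  contraction costs nothing. The summand 1 in \<open>r\<close> keeps it positive when
  \<open>T = 0\<close>.\<close>

lemma adjoint_factorization:
  assumes "\<exists>D::'a::complex_hilbert_space set. countable D \<and> closure D = UNIV"
    and T: "T \<in> BH" "T' \<in> BH" and adj: "adjoint_pair T (T' :: 'a \<Rightarrow>\<^sub>L 'a)"
  shows "\<exists>R\<in>BH. T' = R o\<^sub>L T o\<^sub>L R"
proof -
  define r where "r = inverse (norm T + 1)"
  have r: "0 < r" unfolding r_def by (simp add: add_nonneg_pos)
  have "norm (r *\<^sub>R T) \<le> 1" by (simp add: r_def divide_simps add_nonneg_pos abs_of_pos)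
  then obtain R where "R \<in> BH" "r *\<^sub>R T' = R o\<^sub>L (r *\<^sub>R T) o\<^sub>L R"
    using adjoint_factorization_contraction[OF assms(1) BH_scaleR BH_scaleR adjoint_pair_scaleR]
      T adj by blast
  moreover have "R o\<^sub>L (r *\<^sub>R T) o\<^sub>L R = r *\<^sub>R (R o\<^sub>L T o\<^sub>L R)" for R
    by (rule blinfun_eqI) (simp add: blinfun.bilinear_simps)
  ultimately show ?thesis using r by auto
qed

section \<open>Ideals of operators\<close>

lemma subideal_subset: "subideal J I \<Longrightarrow> I \<subseteq> J"
  and subideal_subspace: "subideal J I \<Longrightarrow> op.subspace I"
  and subideal_left: "subideal J I \<Longrightarrow> A \<in> J \<Longrightarrow> X \<in> I \<Longrightarrow> A o\<^sub>L X \<in> I"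
  and subideal_right: "subideal J I \<Longrightarrow> A \<in> J \<Longrightarrow> X \<in> I \<Longrightarrow> X o\<^sub>L A \<in> I"
  by (auto simp: subideal_def)

lemma blinfun_compose_assoc: "(A o\<^sub>L B) o\<^sub>L C = A o\<^sub>L (B o\<^sub>L C)"
  by (rule blinfun_eqI) simp

lemma scale_op_compose_left: "scale_op c (A o\<^sub>L B) = scale_op c A o\<^sub>L B"
  by (rule blinfun_eqI) (simp add: scale_op.rep_eq)

lemma scale_op_compose_right: "A \<in> BH \<Longrightarrow> scale_op c (A o\<^sub>L B) = A o\<^sub>L scale_op c B"
  by (rule blinfun_eqI) (simp add: scale_op.rep_eq BH_scaleC)

lemmas compose_simps =
  bounded_bilinear.add_left[OF bounded_bilinear_blinfun_compose]
  bounded_bilinear.add_right[OF bounded_bilinear_blinfun_compose]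
  bounded_bilinear.zero_left[OF bounded_bilinear_blinfun_compose]
  bounded_bilinear.zero_right[OF bounded_bilinear_blinfun_compose]
  bounded_bilinear.sum_right[OF bounded_bilinear_blinfun_compose]

lemma subspace_left_compose:
  assumes "op.subspace K" "A \<in> BH"
  shows "op.subspace {X. A o\<^sub>L X \<in> K}"
  using assms(1) unfolding op.subspace_def
  by (simp add: compose_simps scale_op_compose_right[OF assms(2), symmetric])

lemma subspace_right_compose:
  assumes "op.subspace K"
  shows "op.subspace {X. X o\<^sub>L A \<in> K}"
  using assms unfolding op.subspace_def
  by (simp add: compose_simps scale_op_compose_left[symmetric])

text \<open>Scalars are absorbed into the left factors, which stay in the subspace \<open>I\<close>.
  Inclusions of products thereby reduce to single products.\<close>

lemma ideal_prod_eq_span: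
  assumes "op.subspace I"
  shows "ideal_prod I J = op.span {A o\<^sub>L B | A B. A \<in> I \<and> B \<in> J}"
proof (intro equalityI subsetI)
  fix X assume "X \<in> ideal_prod I J"
  then obtain n A B where "X = (\<Sum>i<n. A i o\<^sub>L B i)" "\<forall>i<(n::nat). A i \<in> I \<and> B i \<in> J"
    unfolding ideal_prod_def by blast
  then show "X \<in> op.span {A o\<^sub>L B | A B. A \<in> I \<and> B \<in> J}"
    by (auto intro!: op.span_sum intro: op.span_base)
next
  fix X assume "X \<in> op.span {A o\<^sub>L B | A B. A \<in> I \<and> B \<in> J}"
  then obtain t r where t: "finite t" "t \<subseteq> {A o\<^sub>L B | A B. A \<in> I \<and> B \<in> J}"
    and X: "X = (\<Sum>a\<in>t. scale_op (r a) a)"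
    unfolding op.span_explicit by blast
  have "\<forall>a\<in>t. \<exists>A B. a = A o\<^sub>L B \<and> A \<in> I \<and> B \<in> J" using t(2) by blast
  then obtain A B where AB: "\<And>a. a \<in> t \<Longrightarrow> a = A a o\<^sub>L B a" "\<And>a. a \<in> t \<Longrightarrow> A a \<in> I \<and> B a \<in> J"
    by metis
  obtain h where h: "bij_betw h {..<card t} t"
    using ex_bij_betw_nat_finite[OF t(1)] by (auto simp: atLeast0LessThan)
  have ht: "h i \<in> t" if "i < card t" for i using h that by (auto simp: bij_betw_def)
  have "X = (\<Sum>i<card t. scale_op (r (h i)) (h i))"
    unfolding X by (rule sum.reindex_bij_betw[OF h, symmetric])
  also have "\<dots> = (\<Sum>i<card t. scale_op (r (h i)) (A (h i)) o\<^sub>L B (h i))"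
    using AB(1) ht by (intro sum.cong) (auto simp: scale_op_compose_left[symmetric])
  finally show "X \<in> ideal_prod I J"
    unfolding ideal_prod_def using AB(2) ht op.subspace_scale[OF assms]
    by (intro CollectI exI[of _ "card t"] exI[of _ "\<lambda>i. scale_op (r (h i)) (A (h i))"]
        exI[of _ "\<lambda>i. B (h i)"]) auto
qed

lemma ideal_prodI:
  "A \<in> I \<Longrightarrow> B \<in> J \<Longrightarrow> A o\<^sub>L B \<in> ideal_prod I J"
  unfolding ideal_prod_def
  by (intro CollectI exI[of _ "1::nat"] exI[of _ "\<lambda>i. A"] exI[of _ "\<lambda>i. B"]) auto

lemma ideal_prod_minimal:
  assumes "op.subspace I" "op.subspace M" "\<And>A B. A \<in> I \<Longrightarrow> B \<in> J \<Longrightarrow> A o\<^sub>L B \<in> M"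
  shows "ideal_prod I J \<subseteq> M"
  unfolding ideal_prod_eq_span[OF assms(1)] using assms(2,3) by (intro op.span_minimal) auto

lemma subspace_ideal_prod: "op.subspace I \<Longrightarrow> op.subspace (ideal_prod I J)"
  by (simp add: ideal_prod_eq_span op.subspace_span)

lemma BH_ideal_prod:
  assumes I: "BH_ideal I" and J: "BH_ideal J"
  shows "BH_ideal (ideal_prod I J)"
  unfolding subideal_def
proof (intro conjI ballI)
  note sI = subideal_subspace[OF I]
  show sub: "op.subspace (ideal_prod I J)" by (rule subspace_ideal_prod[OF sI])
  show "ideal_prod I J \<subseteq> BH"
    using subideal_subset[OF I] subideal_subset[OF J]
    by (intro ideal_prod_minimal sI op_subspace_BH BH_compose) auto
  fix A X :: "'a \<Rightarrow>\<^sub>L 'a" assume A: "A \<in> BH" and X: "X \<in> ideal_prod I J"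
  have "ideal_prod I J \<subseteq> {X. A o\<^sub>L X \<in> ideal_prod I J}"
    using subideal_left[OF I A]
    by (intro ideal_prod_minimal sI subspace_left_compose sub A)
      (auto simp: blinfun_compose_assoc[symmetric] intro: ideal_prodI)
  with X show "A o\<^sub>L X \<in> ideal_prod I J" by blast
  have "ideal_prod I J \<subseteq> {X. X o\<^sub>L A \<in> ideal_prod I J}"
    using subideal_right[OF J A]
    by (intro ideal_prod_minimal sI subspace_right_compose sub)
      (auto simp: blinfun_compose_assoc intro: ideal_prodI)
  with X show "X o\<^sub>L A \<in> ideal_prod I J" by blast
qed

lemma ideal_prod_subset_left: "BH_ideal I \<Longrightarrow> J \<subseteq> BH \<Longrightarrow> ideal_prod I J \<subseteq> I"
  by (intro ideal_prod_minimal) (auto intro: subideal_subspace subideal_right)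

text \<open>\<open>A o\<^sub>L B\<close> is the adjoint of \<open>B' o\<^sub>L A'\<close>, and by
  factorization ideals contain the adjoints of their elements. A third factorization writes it as
  \<open>R o\<^sub>L B'\<close> times \<open>A' o\<^sub>L R\<close>, with factors in
  \<open>J\<close> and \<open>I\<close>.\<close>

lemma ideal_prod_subset_commute:
  assumes sep: "\<exists>D::'a::complex_hilbert_space set. countable D \<and> closure D = UNIV"
    and e: "orthonormal_basis (e :: nat \<Rightarrow> 'a)"
    and I: "BH_ideal I" and J: "BH_ideal (J :: ('a \<Rightarrow>\<^sub>L 'a) set)"
  shows "ideal_prod I J \<subseteq> ideal_prod J I"
proof (intro ideal_prod_minimal subideal_subspace[OF I] subspace_ideal_prod[OF subideal_subspace[OF J]])
  fix A B assume AB: "A \<in> I" "B \<in> J"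
  have BH: "A \<in> BH" "B \<in> BH" using AB subideal_subset[OF I] subideal_subset[OF J] by auto
  obtain A' B' where adj: "A' \<in> BH" "adjoint_pair A A'" "B' \<in> BH" "adjoint_pair B B'"
    using exists_adjoint[OF e] BH by metis
  obtain RA where RA: "RA \<in> BH" "A' = RA o\<^sub>L A o\<^sub>L RA"
    using adjoint_factorization[OF sep BH(1) adj(1,2)] by blast
  then have A': "A' \<in> I" using AB(1) I by (simp add: subideal_left subideal_right)
  obtain RB where RB: "RB \<in> BH" "B' = RB o\<^sub>L B o\<^sub>L RB"
    using adjoint_factorization[OF sep BH(2) adj(3,4)] by blast
  then have B': "B' \<in> J" using AB(2) J by (simp add: subideal_left subideal_right)
  have "adjoint_pair (B' o\<^sub>L A') (A o\<^sub>L B)"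
    using adjoint_pair_compose[OF adj(2,4)] by (rule adjoint_pair_commute)
  then obtain R where R: "R \<in> BH" "A o\<^sub>L B = R o\<^sub>L (B' o\<^sub>L A') o\<^sub>L R"
    using adjoint_factorization[OF sep BH_compose[OF adj(3,1)] BH_compose[OF BH]] by blast
  have "(R o\<^sub>L B') o\<^sub>L (A' o\<^sub>L R) \<in> ideal_prod J I"
    using A' B' R(1) I J by (intro ideal_prodI) (auto intro: subideal_left subideal_right)
  then show "A o\<^sub>L B \<in> ideal_prod J I" by (simp add: R(2) blinfun_compose_assoc)
qed

text \<open>The operators that two-sided multiplication by \<open>J\<close> carries into
  \<open>I\<close> form a \<open>BH\<close>-ideal \<open>?M\<close> containing \<open>I\<close>,
  hence the hull. Softness and commutation write elements of the hull as sums of such two-sided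
  multiples of hull elements, so the hull is \<open>I\<close>.\<close>

lemma BH_ideal_if_soft_hull:
  assumes sep: "\<exists>D::'a::complex_hilbert_space set. countable D \<and> closure D = UNIV"
    and e: "orthonormal_basis (e :: nat \<Rightarrow> 'a)"
    and J: "BH_ideal (J :: ('a \<Rightarrow>\<^sub>L 'a) set)" and I: "subideal J I" and soft: "soft J (BH_ideal hull I)"
  shows "BH_ideal I"
proof -
  let ?L = "BH_ideal hull I"
  note JBH = subideal_subset[OF J]
  have L: "BH_ideal ?L"
    using subideal_subset[OF I] JBH by (intro subideal_hull BH_ideal_BH) auto
  have LJ: "ideal_prod ?L J = ?L" using soft by (simp add: soft_def)
  then have LJ': "?L \<subseteq> ideal_prod J ?L" using ideal_prod_subset_commute[OF sep e L J] by simp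
  let ?M = "{Y \<in> BH. \<forall>A\<in>J. \<forall>B\<in>J. A o\<^sub>L Y o\<^sub>L B \<in> I}"
  have "BH_ideal ?M"
    unfolding subideal_def
  proof (intro conjI ballI)
    show "op.subspace ?M"
    proof -
      have "op.subspace {Y. A o\<^sub>L Y o\<^sub>L B \<in> I}" if "A \<in> J" for A B
        using subspace_left_compose[OF subspace_right_compose[OF subideal_subspace[OF I]], of A B]
          that JBH by auto
      moreover have "?M = BH \<inter> (\<Inter>A\<in>J. \<Inter>B\<in>J. {Y. A o\<^sub>L Y o\<^sub>L B \<in> I})" by blast
      ultimately show ?thesis by (simp add: op.subspace_inter op.subspace_Int op_subspace_BH)
    qed
    fix C Y :: "'a \<Rightarrow>\<^sub>L 'a" assume C: "C \<in> BH" and Y: "Y \<in> ?M"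
    have "(A o\<^sub>L C) o\<^sub>L Y o\<^sub>L B \<in> I" if "A \<in> J" "B \<in> J" for A B
      using Y that subideal_right[OF J C] by blast
    then show "C o\<^sub>L Y \<in> ?M" using C Y by (simp add: blinfun_compose_assoc BH_compose)
    have "A o\<^sub>L Y o\<^sub>L (C o\<^sub>L B) \<in> I" if "A \<in> J" "B \<in> J" for A B
      using Y that subideal_left[OF J C] by blast
    then show "Y o\<^sub>L C \<in> ?M" using C Y by (simp add: blinfun_compose_assoc BH_compose)
  qed blast
  moreover have "I \<subseteq> ?M"
    using subideal_subset[OF I] JBH I by (auto intro: subideal_left subideal_right)
  ultimately have LM: "?L \<subseteq> ?M" by (simp add: hull_minimal)
  \<comment> \<open>By \<open>LJ'\<close>, \<open>Y\<close> is a sum of products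
    \<open>A o\<^sub>L Z\<close> with \<open>A \<in> J\<close> and \<open>Z\<close> in the hull, and
    \<open>LM\<close> puts \<open>A o\<^sub>L Z o\<^sub>L B\<close> into \<open>I\<close>.\<close>
  have "Y o\<^sub>L B \<in> I" if "Y \<in> ?L" "B \<in> J" for Y B
  proof -
    have "ideal_prod J ?L \<subseteq> {Y. Y o\<^sub>L B \<in> I}"
      using LM \<open>B \<in> J\<close>
      by (intro ideal_prod_minimal subideal_subspace[OF J] subspace_right_compose subideal_subspace[OF I])
        auto
    with LJ' that show ?thesis by blast
  qed
  then have "ideal_prod ?L J \<subseteq> I"
    by (intro ideal_prod_minimal subideal_subspace[OF L] subideal_subspace[OF I])
  then have "?L = I" using LJ hull_subset[of I BH_ideal] by auto
  with L show ?thesis by simp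
qed

section \<open>Rank-one operators and almost disjoint isometries\<close>

lift_definition rank_one :: "'a \<Rightarrow> 'a \<Rightarrow> 'a::complex_hilbert_space \<Rightarrow>\<^sub>L 'a"
  is "\<lambda>a b x. cinner x a *\<^sub>C b"
  by (rule bounded_linear_intro[where K = "norm a * norm b" for a b])
    (auto simp: cinner_simps scaleC_add_left scaleR_eq_scaleC scaleC_scaleC norm_scaleC
      intro!: mult_right_mono cmod_cinner_le simp flip: mult.assoc)

lemma rank_one_BH: "rank_one a b \<in> BH"
  by (simp add: BH_def rank_one.rep_eq cinner_simps scaleC_scaleC)

text \<open>Sandwiching \<open>X\<close> routes a vector through \<open>u\<close> and
  \<open>v = X u\<close> to \<open>b\<close>, at the cost of the nonzero factor
  \<open>cinner v v\<close>, which is divided out.\<close>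

lemma rank_one_in_ideal:
  assumes K: "BH_ideal K" and X: "X \<in> K" "X \<noteq> 0"
  shows "rank_one a b \<in> K"
proof -
  obtain u where u: "blinfun_apply X u \<noteq> 0" using X(2) by (metis blinfun_eqI zero_blinfun.rep_eq)
  define v where "v = blinfun_apply X u"
  have XBH: "X \<in> BH" using X(1) subideal_subset[OF K] by blast
  have v: "cinner v v \<noteq> 0" using u by (simp add: v_def cinner_self)
  have "rank_one a b = scale_op (inverse (cinner v v)) (rank_one v b o\<^sub>L X o\<^sub>L rank_one a u)"
    using v by (intro blinfun_eqI)
      (simp add: rank_one.rep_eq scale_op.rep_eq BH_scaleC[OF XBH] v_def[symmetric]
        cinner_simps scaleC_scaleC)
  also have "\<dots> \<in> K"
    by (intro op.subspace_scale subideal_subspace[OF K] subideal_left[OF K] subideal_right[OF K]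
        rank_one_BH X(1))
  finally show ?thesis .
qed

text \<open>Initial segments of the characteristic functions of distinct sets of naturals agree only up
  to the first difference, so their codes form an almost disjoint family.\<close>

definition prefix_code :: "nat set \<Rightarrow> nat \<Rightarrow> nat"
  where "prefix_code s n = to_nat (map (\<lambda>i. i \<in> s) [0..<n])"

lemma prefix_code_eqD:
  assumes "prefix_code s m = prefix_code t n"
  shows "m = n \<and> (\<forall>i<n. i \<in> s \<longleftrightarrow> i \<in> t)"
proof -
  have eq: "map (\<lambda>i. i \<in> s) [0..<m] = map (\<lambda>i. i \<in> t) [0..<n]"
    using assms by (simp add: prefix_code_def)
  then have "m = n" using map_eq_imp_length_eq by fastforce
  with eq show ?thesis by simp
qed

text \<open>\<open>V s\<close> sends \<open>e n\<close> to \<open>e (prefix_code s n)\<close>;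
  \<open>W s\<close> undoes this and kills what is orthogonal to these vectors. Codes of different
  lengths differ, so \<open>W s o\<^sub>L V t\<close> fixes \<open>e n\<close> where the
  \<open>n\<close>-th codes agree and kills it elsewhere.\<close>

lemma exists_almost_disjoint_isometries:
  assumes e: "orthonormal_basis (e :: nat \<Rightarrow> 'a::complex_hilbert_space)"
  shows "\<exists>V W. (\<forall>s :: nat set. V s \<in> BH \<and> W s \<in> BH \<and> W s o\<^sub>L V s = id_blinfun) \<and>
    (\<forall>s t. s \<noteq> t \<longrightarrow> (\<exists>N. finite N \<and> W s o\<^sub>L V t = (\<Sum>n\<in>N. rank_one (e n) (e n))))"
proof -
  have e': "orthonormal_or_zero e" and ne: "\<And>n. e n \<noteq> 0" using e by (auto simp: orthonormal_basis_def)
  have inj: "prefix_code s m = prefix_code s n \<longleftrightarrow> m = n" for s m n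
    using prefix_code_eqD by blast
  have f: "orthonormal_or_zero (\<lambda>n. e (prefix_code s n))" for s
    using e' by (auto simp: orthonormal_or_zero_def inj)
  have "\<exists>V W. V \<in> BH \<and> W \<in> BH \<and> (\<forall>n. blinfun_apply V (e n) = e (prefix_code s n)) \<and>
      (\<forall>n. blinfun_apply W (e (prefix_code s n)) = e n) \<and>
      (\<forall>x. (\<forall>n. cinner x (e (prefix_code s n)) = 0) \<longrightarrow> blinfun_apply W x = 0)" for s
    using exists_partial_isometry[OF e' f] ne by blast
  then obtain V W where VW: "\<And>s. V s \<in> BH" "\<And>s. W s \<in> BH"
      "\<And>s n. blinfun_apply (V s) (e n) = e (prefix_code s n)"
      "\<And>s n. blinfun_apply (W s) (e (prefix_code s n)) = e n"
      "\<And>s x. (\<And>n. cinner x (e (prefix_code s n)) = 0) \<Longrightarrow> blinfun_apply (W s) x = 0"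
    by metis
  have "W s o\<^sub>L V s = id_blinfun" for s
    by (rule BH_eqI[OF e BH_compose[OF VW(2,1)] BH_id]) (simp add: VW(3,4))
  moreover have "\<exists>N. finite N \<and> W s o\<^sub>L V t = (\<Sum>n\<in>N. rank_one (e n) (e n))" if st: "s \<noteq> t" for s t
  proof -
    obtain k where k: "k \<in> s \<longleftrightarrow> k \<notin> t" using st by blast
    define N where "N = {n. prefix_code s n = prefix_code t n}"
    \<comment> \<open>A prefix of length \<open>n\<close> records only indices below
      \<open>n\<close>, so agreement is still possible at \<open>n = k\<close> but not
      beyond.\<close>
    have "n \<le> k" if "n \<in> N" for n
      using prefix_code_eqD[of s n t n] that k by (auto simp: N_def intro: leI)
    then have fin: "finite N" by (meson finite_nat_set_iff_bounded_le)
    have "W s o\<^sub>L V t = (\<Sum>n\<in>N. rank_one (e n) (e n))"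
    proof (rule BH_eqI[OF e BH_compose[OF VW(2,1)] BH_sum[OF fin rank_one_BH]])
      fix n
      have "(\<Sum>m\<in>N. cinner (e n) (e m) *\<^sub>C e m) = (\<Sum>m\<in>N. if m = n then e n else 0)"
        by (rule sum.cong) (auto simp: cinner_orthonormal_or_zero[OF e'] ne)
      then have r: "blinfun_apply (\<Sum>n\<in>N. rank_one (e n) (e n)) (e n) = (if n \<in> N then e n else 0)"
        using fin by (simp add: blinfun.sum_left rank_one.rep_eq)
      show "blinfun_apply (W s o\<^sub>L V t) (e n) = blinfun_apply (\<Sum>n\<in>N. rank_one (e n) (e n)) (e n)"
      proof (cases "n \<in> N")
        case True
        then have "prefix_code t n = prefix_code s n" by (simp add: N_def)
        with True show ?thesis by (simp add: r VW(3,4))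
      next
        case False
        then have "prefix_code t n \<noteq> prefix_code s m" for m
          using prefix_code_eqD[of t n s m] by (auto simp: N_def)
        then have "blinfun_apply (W s) (e (prefix_code t n)) = 0"
          by (intro VW(5)) (simp add: cinner_orthonormal_or_zero[OF e'])
        with False show ?thesis by (simp add: r VW(3))
      qed
    qed
    with fin show ?thesis by blast
  qed
  ultimately show ?thesis using VW(1,2) by (intro exI[of _ V] exI[of _ W]) simp
qed

text \<open>An operator \<open>T\<close> in \<open>I\<close> outside \<open>K\<close> would give
  continuum many operators \<open>V s o\<^sub>L T\<close> in \<open>I\<close>, independent modulo
  \<open>K\<close>. The nonzero element from \<open>K0\<close> brings the rank-one operators into
  \<open>K\<close>.\<close>

lemma BH_ideals_eq_if_small_quotient:
  assumes e: "orthonormal_basis (e :: nat \<Rightarrow> 'a::complex_hilbert_space)"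
    and I: "BH_ideal I" and K: "BH_ideal (K :: ('a \<Rightarrow>\<^sub>L 'a) set)" and KI: "K \<subseteq> I"
    and K0: "\<exists>X\<in>K. X \<noteq> 0"
    and R: "R \<prec> (UNIV :: real set)" "I \<subseteq> op.span (R \<union> K)"
  shows "I = K"
proof (rule ccontr)
  assume "I \<noteq> K"
  then obtain T where T: "T \<in> I" "T \<notin> K" using KI by blast
  note sK = subideal_subspace[OF K]
  obtain V W where VW: "\<And>s :: nat set. V s \<in> BH" "\<And>s. W s \<in> BH"
      "\<And>s. W s o\<^sub>L V s = (id_blinfun :: 'a \<Rightarrow>\<^sub>L 'a)"
    and fin: "\<And>s t. s \<noteq> t \<Longrightarrow> \<exists>N. finite N \<and> W s o\<^sub>L V t = (\<Sum>n\<in>N. rank_one (e n) (e n))"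
    using exists_almost_disjoint_isometries[OF e] by metis
  have WVK: "W s o\<^sub>L V t \<in> K" if st: "s \<noteq> t" for s t
  proof -
    obtain N where "W s o\<^sub>L V t = (\<Sum>n\<in>N. rank_one (e n) (e n))" using fin[OF st] by blast
    then show ?thesis using K0 rank_one_in_ideal[OF K] by (auto intro!: op.subspace_sum[OF sK])
  qed
  have "\<not> R \<prec> (UNIV :: real set)"
  proof (rule op.independent_mod_family_le[OF sK, of "\<lambda>s. V s o\<^sub>L T"])
    show "range (\<lambda>s. V s o\<^sub>L T) \<subseteq> op.span (R \<union> K)"
      using R(2) subideal_left[OF I VW(1) T(1)] by blast
    fix F c s
    assume F: "finite F" and sum: "(\<Sum>t\<in>F. scale_op (c t) (V t o\<^sub>L T)) \<in> K" and s: "s \<in> F"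
    \<comment> \<open>Multiplying by \<open>W s\<close> isolates one coefficient: the term for
      \<open>s\<close> becomes a multiple of \<open>T\<close>, and all others fall into
      \<open>K\<close>.\<close>
    have eq: "W s o\<^sub>L (\<Sum>t\<in>F. scale_op (c t) (V t o\<^sub>L T)) = (\<Sum>t\<in>F. scale_op (c t) ((W s o\<^sub>L V t) o\<^sub>L T))"
      by (simp only: compose_simps(5) scale_op_compose_right[OF VW(2), symmetric] blinfun_compose_assoc)
    have "id_blinfun o\<^sub>L T = T" by (rule blinfun_eqI) simp
    then have "(\<Sum>t\<in>F. scale_op (c t) ((W s o\<^sub>L V t) o\<^sub>L T))
        = scale_op (c s) T + (\<Sum>t\<in>F - {s}. scale_op (c t) ((W s o\<^sub>L V t) o\<^sub>L T))"
      using F s by (simp add: sum.remove VW(3))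
    with eq have "scale_op (c s) T + (\<Sum>t\<in>F - {s}. scale_op (c t) ((W s o\<^sub>L V t) o\<^sub>L T)) \<in> K"
      using subideal_left[OF K VW(2) sum, of s] by simp
    moreover have "(W s o\<^sub>L V t) o\<^sub>L T \<in> K" if "s \<noteq> t" for t
      using subideal_right[OF K _ WVK[OF that]] T(1) subideal_subset[OF I] by blast
    then have "(\<Sum>t\<in>F - {s}. scale_op (c t) ((W s o\<^sub>L V t) o\<^sub>L T)) \<in> K"
      by (intro op.subspace_sum[OF sK] op.subspace_scale[OF sK]) auto
    ultimately have cT: "scale_op (c s) T \<in> K" using op.subspace_diff[OF sK] by fastforce
    show "c s = 0"
    proof (rule ccontr)
      assume "c s \<noteq> 0"
      then have "T = scale_op (inverse (c s)) (scale_op (c s) T)" by simp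
      then show False using T(2) op.subspace_scale[OF sK cT] by metis
    qed
  qed
  with R(1) show False by blast
qed

text \<open>With \<open>v = X u\<close> nonzero, \<open>rank_one v u o\<^sub>L X\<close> lies in
  \<open>I \<subseteq> J\<close>, and \<open>X\<close> times it sends \<open>u\<close> to a nonzero
  multiple of \<open>v\<close>.\<close>

lemma ideal_prod_nonzero:
  assumes I: "BH_ideal I" and IJ: "I \<subseteq> J" and X: "X \<in> I" "X \<noteq> 0"
  shows "\<exists>Y\<in>ideal_prod I J. Y \<noteq> 0"
proof -
  obtain u where u: "blinfun_apply X u \<noteq> 0" using X(2) by (metis blinfun_eqI zero_blinfun.rep_eq)
  let ?v = "blinfun_apply X u"
  have XBH: "X \<in> BH" using X(1) subideal_subset[OF I] by blast
  have "blinfun_apply (X o\<^sub>L (rank_one ?v u o\<^sub>L X)) u = cinner ?v ?v *\<^sub>C ?v"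
    by (simp add: rank_one.rep_eq BH_scaleC[OF XBH])
  then have "X o\<^sub>L (rank_one ?v u o\<^sub>L X) \<noteq> 0"
    using u by (metis cinner_self cvec.scale_eq_0_iff norm_eq_zero of_real_eq_0_iff power_eq_0_iff
        zero_blinfun.rep_eq)
  moreover have "X o\<^sub>L (rank_one ?v u o\<^sub>L X) \<in> ideal_prod I J"
    using X(1) IJ subideal_left[OF I rank_one_BH X(1)] by (intro ideal_prodI) auto
  ultimately show ?thesis by blast
qed

section \<open>Softness from small quotients\<close>

lemma soft_if_small_quotient:
  assumes e: "orthonormal_basis (e :: nat \<Rightarrow> 'a::complex_hilbert_space)"
    and J: "BH_ideal (J :: ('a \<Rightarrow>\<^sub>L 'a) set)" and I: "BH_ideal I" and IJ: "I \<subseteq> J"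
    and R: "R \<prec> (UNIV :: real set)" "I \<subseteq> op.span (R \<union> ideal_prod I J)"
  shows "soft J I"
proof (cases "\<exists>X\<in>I. X \<noteq> 0")
  case True
  then obtain X where "X \<in> I" "X \<noteq> 0" by blast
  then show ?thesis
    using BH_ideals_eq_if_small_quotient[OF e I BH_ideal_prod[OF I J]
        ideal_prod_subset_left[OF I subideal_subset[OF J]] ideal_prod_nonzero[OF I IJ] R]
    by (simp add: soft_def)
next
  \<comment> \<open>The zero ideal offers no nonzero operator from which to build rank-one
    operators; here the product and \<open>I\<close> are both zero.\<close>
  case False
  then show ?thesis
    using ideal_prod_subset_left[OF I subideal_subset[OF J]]
      op.subspace_0[OF subspace_ideal_prod[OF subideal_subspace[OF I], of J]]
    by (auto simp: soft_def)
qed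

lemma subspace_set_plus: "op.subspace V \<Longrightarrow> op.subspace W \<Longrightarrow> op.subspace (V + W)"
  using op.subspace_sums[of V W] by (simp add: set_plus_def Bex_def conj_commute) (smt (verit) Collect_cong)

text \<open>Representatives of the basis cosets form \<open>R\<close>; an equation between cosets
  determines \<open>v\<close> up to an element of \<open>W\<close>.\<close>

lemma quotient_basis_spanning:
  assumes W: "op.subspace W" and B: "quotient_basis scale_op V W B"
  shows "\<exists>R. R \<lesssim> B \<and> V \<subseteq> op.span (R \<union> W)"
proof -
  have "\<forall>X\<in>B. \<exists>v. X = v +o W"
    using B by (auto simp: quotient_basis_def quotient_space_def)
  then obtain r where r: "\<And>X. X \<in> B \<Longrightarrow> X = r X +o W" by metis
  have "v \<in> op.span (r ` B \<union> W)" if v: "v \<in> V" for v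
  proof -
    have "v +o W \<in> quotient_space V W" using v by (simp add: quotient_space_def)
    then obtain F c where F: "finite F" "F \<subseteq> B" "v +o W = coset_lincomb scale_op W F c"
      using B unfolding quotient_basis_def by metis
    then have "v +o W = (\<Sum>X\<in>F. scale_op (c X) (r X)) +o W"
      using op.coset_lincomb_cosets[OF W F(1), of r c] r by (metis subsetD)
    moreover have "v \<in> v +o W" using op.subspace_0[OF W] by (force simp: elt_set_plus_def)
    ultimately obtain w where w: "w \<in> W" "v = (\<Sum>X\<in>F. scale_op (c X) (r X)) + w"
      by (auto simp: elt_set_plus_def)
    show ?thesis
      unfolding w(2) using F(2) w(1)
      by (intro op.span_add op.span_sum op.span_scale op.span_base) auto
  qed
  then show ?thesis using image_lepoll by blast
qed

theorem theorem4p1: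
  fixes J :: "('a::complex_hilbert_space \<Rightarrow>\<^sub>L 'a) set"
  assumes separable: "\<exists>D::'a set. countable D \<and> closure D = UNIV"
    and infinite_dimensional: "\<nexists>B::'a set. finite B \<and> cvec.span B = UNIV"
    and ideal: "BH_ideal J"
  shows "(\<forall>S. S \<subseteq> J \<and> S \<prec> (UNIV :: real set) \<longrightarrow>
            (BH_ideal (subideal J hull S) \<longleftrightarrow> soft J (BH_ideal hull S)))
       \<and> (\<forall>I. subideal J I \<and>
            (\<exists>B. quotient_basis scale_op I (subideal_core J I) B \<and> B \<prec> (UNIV :: real set)) \<longrightarrow>
            (BH_ideal I \<longleftrightarrow> soft J (BH_ideal hull I)))"
proof -
  obtain e :: "nat \<Rightarrow> 'a" where e: "orthonormal_basis e"
    using exists_orthonormal_basis[OF separable infinite_dimensional] by blast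
  note JBH = subideal_subset[OF ideal]
  note commute = ideal_prod_subset_commute[OF separable e]
  \<comment> \<open>Commutation moves the factor from \<open>J\<close> to the right, so both
    one-sided products land in the same ideal.\<close>
  have left: "A o\<^sub>L X \<in> ideal_prod I J" if "BH_ideal I" "A \<in> J" "X \<in> I" for I A X
    using commute[OF ideal that(1)] ideal_prodI[OF that(2,3)] by blast
  have 1: "BH_ideal (subideal J hull S) \<longleftrightarrow> soft J (BH_ideal hull S)"
    if S: "S \<subseteq> J" "S \<prec> (UNIV :: real set)" for S
  proof -
    let ?I = "subideal J hull S" and ?L = "BH_ideal hull S"
    have I: "subideal J ?I" by (rule subideal_hull[OF ideal S(1)])
    have L: "BH_ideal ?L" using S(1) JBH by (intro subideal_hull BH_ideal_BH) auto
    have LJ: "?L \<subseteq> J" using S(1) ideal by (intro hull_minimal)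
    have "subideal J ?L" using L LJ JBH unfolding subideal_def by blast
    then have IL: "?I \<subseteq> ?L" by (intro hull_minimal hull_subset)
    \<comment> \<open>\<open>?I\<close> lies between \<open>S\<close> and \<open>?L\<close>, so it
      generates the same \<open>BH\<close>-ideal as \<open>S\<close>.\<close>
    have hull: "BH_ideal hull ?I = ?L"
      using hull_minimal[of ?I ?L BH_ideal] IL L hull_mono[OF hull_subset[of S "subideal J"], of BH_ideal]
      by blast
    show ?thesis
    proof
      assume "soft J ?L"
      then show "BH_ideal ?I" using BH_ideal_if_soft_hull[OF separable e ideal I] hull by simp
    next
      assume BI: "BH_ideal ?I"
      then have eq: "?L = ?I" using IL by (simp add: hull_minimal hull_subset subset_antisym)
      let ?K = "ideal_prod ?I J"
      have KI: "?K \<subseteq> ?I" by (rule ideal_prod_subset_left[OF BI JBH])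
      have sp: "op.span (S \<union> ?K) \<subseteq> ?I"
        using KI by (intro op.span_minimal subideal_subspace[OF I]) (auto simp: hull_inc)
      \<comment> \<open>Multiplying any element of \<open>?I\<close> by \<open>J\<close> lands in
        \<open>?K\<close>, so this span is already a \<open>J\<close>-ideal. By minimality of
        \<open>?I\<close>, the small set \<open>S\<close> spans it modulo \<open>?K\<close>.\<close>
      have "subideal J (op.span (S \<union> ?K))"
      proof (intro subideal_def[THEN iffD2] conjI ballI op.subspace_span)
        show "op.span (S \<union> ?K) \<subseteq> J" using sp subideal_subset[OF I] by blast
        fix A X assume "A \<in> J" "X \<in> op.span (S \<union> ?K)"
        then show "A o\<^sub>L X \<in> op.span (S \<union> ?K)" "X o\<^sub>L A \<in> op.span (S \<union> ?K)"
          using sp left[OF BI] by (auto intro: op.span_base ideal_prodI)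
      qed
      then have "?I \<subseteq> op.span (S \<union> ?K)" by (intro hull_minimal) (auto intro: op.span_base)
      then show "soft J ?L"
        unfolding eq by (rule soft_if_small_quotient[OF e ideal BI subideal_subset[OF I] S(2)])
    qed
  qed
  have 2: "BH_ideal I \<longleftrightarrow> soft J (BH_ideal hull I)"
    if I: "subideal J I" and B: "quotient_basis scale_op I (subideal_core J I) B"
      "B \<prec> (UNIV :: real set)" for I B
  proof
    assume "soft J (BH_ideal hull I)"
    then show "BH_ideal I" by (rule BH_ideal_if_soft_hull[OF separable e ideal I])
  next
    assume BI: "BH_ideal I"
    then have hull: "BH_ideal hull I = I" by (simp add: hull_same)
    let ?K = "ideal_prod I J"
    have K: "BH_ideal ?K" by (rule BH_ideal_prod[OF BI ideal])
    note sK = subideal_subspace[OF K]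
    \<comment> \<open>As \<open>I\<close> is its own hull, the triple product is
      \<open>J I J\<close>; commutation gives \<open>J I \<subseteq> I\<close>, and the remaining
      factor \<open>J\<close> on the right puts it into \<open>?K\<close>. A set spanning modulo the
      core therefore spans modulo \<open>?K\<close>.\<close>
    have "subideal_core J I \<subseteq> ?K"
    proof -
      have "op.span ({A o\<^sub>L B | A B. A \<in> I \<and> B \<in> J} \<union> {B o\<^sub>L A | A B. A \<in> I \<and> B \<in> J}) \<subseteq> ?K"
        using left[OF BI] by (intro op.span_minimal sK) (auto intro: ideal_prodI)
      moreover have "ideal_prod (ideal_prod J I) J \<subseteq> ?K"
        using commute[OF ideal BI] ideal_prod_subset_left[OF BI JBH]
        by (intro ideal_prod_minimal subspace_ideal_prod subideal_subspace[OF ideal] sK)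
          (auto intro: ideal_prodI)
      ultimately show ?thesis
        unfolding subideal_core_def hull using op.subspace_add[OF sK] by (auto simp: set_plus_def)
    qed
    moreover have "op.subspace (subideal_core J I)"
      unfolding subideal_core_def
      by (intro subspace_set_plus op.subspace_span subspace_ideal_prod subideal_subspace[OF ideal])
    then obtain R where R: "R \<lesssim> B" "I \<subseteq> op.span (R \<union> subideal_core J I)"
      using quotient_basis_spanning B(1) by blast
    ultimately have "I \<subseteq> op.span (R \<union> ?K)" using op.span_mono by (meson Un_mono order_refl order_trans)
    moreover have "R \<prec> (UNIV :: real set)" using R(1) B(2) by (rule lesspoll_trans1)
    ultimately show "soft J (BH_ideal hull I)"
      unfolding hull by (intro soft_if_small_quotient[OF e ideal BI subideal_subset[OF I]])
  qed
  from 1 2 show ?thesis by blast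
qed

end
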